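(* Let $G=\mathrm{SL}_n(F)$, let $K=\mathrm{SO}_n(F)=\{g\in \mathrm{SL}_n(F): g^Tg=1_n\}$, and let $B\subset G$ be the Iwahori subgroup of $\mathrm{SL}_n(F)$. The map $w\mapsto Kg_wB$ is a bijection from $i\mathsf{SymAPM}_n$ to $K\backslash G/B$, where $g_w\in G$ is the explicit matrix attached to $w$ defined in the context.
   Context: $n$ is a positive integer. $\mathbb{K}$ is a quadratically closed field, i.e. a field of characteristic not equal to $2$ in which every element has a square root; fix $i=\sqrt{-1}\in\mathbb{K}$. $F=\mathbb{K}((t))$ and $A=\mathbb{K}[[t]]$. $1_n$ is the $n\times n$ identity matrix. The Iwahori subgroup $B$ is the subgroup of $\mathrm{SL}_n(A)$ consisting of the matrices that become upper triangular upon setting $t=0$. A monomial matrix is a square matrix with exactly one non-zero entry in each row and column. $i\mathsf{SymAPM}_n\subset \mathrm{SL}_n(F)$ is the set of symmetric $n\times n$ monomial matrices of determinant $1$ such that: (i) if there are any non-zero entries on the diagonal, then the non-zero diagonal entries are of the form $t^a$ and the non-zero off-diagonal entries are of the form $i\,t^a$, $a\in\mathbb{Z}$; (ii) if there are no non-zero entries on the diagonal, then the non-zero entries in the first row and first column are of the form $\pm i\,t^a$, while the remaining non-zero entries are of the form $i\,t^a$, $a\in\mathbb{Z}$ (exponents may vary from entry to entry). For $w\in i\mathsf{SymAPM}_n$ let $\bar w\in S_n$ be the underlying permutation (an involution) and let $c_j\in\mathbb{Z}$ be the exponent of $t$ in the non-zero entry of column $j$, which lies in row $\bar w(j)$; thus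 $c_{\bar w(j)}=c_j$ and $c_1+\dots+c_n=0$. Fix a square root $(t-1)^{1/2}\in A$ of $t-1$. The matrix $g_w\in \mathrm{SL}_n(F)$ is obtained from $w$ by the following replacements (all other entries being zero). (1) If $\bar w$ has at least one fixed point: - if $\bar w(j)=j$ and $c_j$ is even, replace the $(j,j)$ entry with $t^{c_j/2}$; - the number of indices $j$ with $\bar w(j)=j$ and $c_j$ odd is even; list them as $j_1<j_2<\dots<j_{2\ell}$ and pair $j_1$ with $j_2$, $j_3$ with $j_4$, ..., $j_{2\ell-1}$ with $j_{2\ell}$; for each such pair $j<k$, with $a=c_j$ and $b=c_k$, replace the $2\times2$ submatrix in rows and columns $\{j,k\}$ with $$\begin{pmatrix} t^{\frac{a-1}{2}} & -(t-1)^{\frac12}t^{\frac{b-1}{2}}\\ t^{\frac{a-1}{2}}(t-1)^{\frac12} & t^{\frac{b-1}{2}}\end{pmatrix};$$ - for each $2$-cycle $(j\,k)$ of $\bar w$ with $j<k$ and $a=c_j=c_k$, replace the $2\times2$ submatrix in rows and columns $\{j,k\}$ with $$\begin{pmatrix} t^a/2 & i\\ i\,t^a/2 & 1\end{pmatrix}.$$ (2) If $\bar w$ has no fixed points and the non-zero entry of the first row of $w$ is of the form $+i\,t^a$: for every $2$-cycle $(j\,k)$ of $\bar w$ make the replacement of the last item of (1). (3) If $\bar w$ has no fixed points and the non-zero entry of the first row of $w$ is of the form $-i\,t^a$: proceed as in (2), except that for the $2$-cycle $(1\,k)$ containing $1$, with $a=c_1=c_k$, the $2\times2$ submatrix in rows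 and columns $\{1,k\}$ is replaced with $$\begin{pmatrix} i & -t^a/2\\ 1 & -i\,t^a/2\end{pmatrix}.$$ *)

theory Defs
  imports
    "Jordan_Normal_Form.Determinant"
    "HOL-Computational_Algebra.Formal_Laurent_Series"
begin

text \<open>
  The field of Laurent series over \<open>'k\<close> is \<^typ>\<open>'k fls\<close>, its subring of power series is
  \<^typ>\<open>'k fps\<close>, embedded by \<^const>\<open>fps_to_fls\<close>. Rows and columns are numbered from \<open>0\<close>
  to \<open>n - 1\<close>, so the first row has index \<open>0\<close>.
\<close>

definition quadratically_closed :: "'k::field itself \<Rightarrow> bool" where
  "quadratically_closed _ \<longleftrightarrow> CHAR('k) \<noteq> 2 \<and> (\<forall>x::'k. \<exists>y. y ^ 2 = x)"

definition SL :: "nat \<Rightarrow> 'a::comm_ring_1 mat set" where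
  "SL n = {g \<in> carrier_mat n n. det g = 1}"

definition SO :: "nat \<Rightarrow> 'a::comm_ring_1 mat set" where
  "SO n = {g \<in> SL n. g\<^sup>T * g = 1\<^sub>m n}"

definition Iwahori :: "nat \<Rightarrow> 'k::field fls mat set" where
  "Iwahori n = map_mat fps_to_fls `
     {b \<in> SL n. upper_triangular (map_mat (\<lambda>f. fps_nth f 0) b)}"

definition double_coset :: "'a::semiring_0 mat set \<Rightarrow> 'a mat \<Rightarrow> 'a mat set \<Rightarrow> 'a mat set" where
  "double_coset K g B = {k * g * b | k b. k \<in> K \<and> b \<in> B}"

definition double_cosets ::
    "'a::semiring_0 mat set \<Rightarrow> 'a mat set \<Rightarrow> 'a mat set \<Rightarrow> 'a mat set set" where
  "double_cosets K G B = (\<lambda>g. double_coset K g B) ` G"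

definition monomial_mat :: "nat \<Rightarrow> 'a::zero mat \<Rightarrow> bool" where
  "monomial_mat n w \<longleftrightarrow> w \<in> carrier_mat n n \<and>
     (\<forall>p<n. \<exists>!q. q < n \<and> w $$ (p, q) \<noteq> 0) \<and>
     (\<forall>q<n. \<exists>!p. p < n \<and> w $$ (p, q) \<noteq> 0)"

definition tmono :: "'k::field \<Rightarrow> int \<Rightarrow> 'k fls" where
  "tmono x a = fls_const x * fls_X_intpow a"

text \<open>In the following, \<open>im\<close> is the chosen square root of \<open>-1\<close>.\<close>

definition iSymAPM :: "'k::field \<Rightarrow> nat \<Rightarrow> 'k fls mat set" where
  "iSymAPM im n = {w \<in> SL n. monomial_mat n w \<and> w\<^sup>T = w \<and>
     (if \<exists>p<n. w $$ (p, p) \<noteq> 0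
      then (\<forall>p<n. w $$ (p, p) \<noteq> 0 \<longrightarrow> (\<exists>a. w $$ (p, p) = tmono 1 a)) \<and>
           (\<forall>p<n. \<forall>q<n. p \<noteq> q \<and> w $$ (p, q) \<noteq> 0 \<longrightarrow> (\<exists>a. w $$ (p, q) = tmono im a))
      else (\<forall>p<n. \<forall>q<n. w $$ (p, q) \<noteq> 0 \<longrightarrow>
             (if p = 0 \<or> q = 0
              then \<exists>a. w $$ (p, q) = tmono im a \<or> w $$ (p, q) = tmono (- im) a
              else \<exists>a. w $$ (p, q) = tmono im a)))}"

definition perm_of :: "nat \<Rightarrow> 'a::zero mat \<Rightarrow> nat \<Rightarrow> nat" where
  "perm_of n w j = (THE p. p < n \<and> w $$ (p, j) \<noteq> 0)"

text \<open>The exponent of \<open>t\<close> in a nonzero entry \<open>x * t^a\<close>, for a constant \<open>x\<close>, is the order of this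
  Laurent series.\<close>

definition expo :: "nat \<Rightarrow> 'k::field fls mat \<Rightarrow> nat \<Rightarrow> int" where
  "expo n w j = fls_subdegree (w $$ (perm_of n w j, j))"

definition even_fixed :: "nat \<Rightarrow> 'k::field fls mat \<Rightarrow> nat set" where
  "even_fixed n w = {j. j < n \<and> perm_of n w j = j \<and> even (expo n w j)}"

definition odd_fixed :: "nat \<Rightarrow> 'k::field fls mat \<Rightarrow> nat list" where
  "odd_fixed n w = sorted_list_of_set {j. j < n \<and> perm_of n w j = j \<and> odd (expo n w j)}"

definition odd_pairs :: "nat \<Rightarrow> 'k::field fls mat \<Rightarrow> (nat \<times> nat) set" where
  "odd_pairs n w =
     {(odd_fixed n w ! (2 * m), odd_fixed n w ! (2 * m + 1)) | m. 2 * m + 1 < length (odd_fixed n w)}"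

definition two_cycles :: "nat \<Rightarrow> 'k::field fls mat \<Rightarrow> (nat \<times> nat) set" where
  "two_cycles n w = {(j, k). j < k \<and> k < n \<and> perm_of n w j = k \<and> perm_of n w k = j}"

text \<open>\<open>block j k x\<^sub>1 x\<^sub>2 x\<^sub>3 x\<^sub>4\<close> is the entry function of the matrix whose submatrix in rows and
  columns \<open>{j, k}\<close> has rows \<open>(x\<^sub>1, x\<^sub>2)\<close> and \<open>(x\<^sub>3, x\<^sub>4)\<close>, and which is zero elsewhere.\<close>

definition block :: "nat \<Rightarrow> nat \<Rightarrow> 'a::zero \<Rightarrow> 'a \<Rightarrow> 'a \<Rightarrow> 'a \<Rightarrow> nat \<times> nat \<Rightarrow> 'a" where
  "block j k x1 x2 x3 x4 pq =
     (if pq = (j, j) then x1 else if pq = (j, k) then x2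
      else if pq = (k, j) then x3 else if pq = (k, k) then x4 else 0)"

definition odd_block ::
    "'k::field fps \<Rightarrow> nat \<Rightarrow> 'k fls mat \<Rightarrow> nat \<times> nat \<Rightarrow> nat \<times> nat \<Rightarrow> 'k fls" where
  "odd_block s n w = (\<lambda>(j, k).
     let a' = (expo n w j - 1) div 2; b' = (expo n w k - 1) div 2; r = fps_to_fls s in
     block j k (fls_X_intpow a')     (- r * fls_X_intpow b')
               (fls_X_intpow a' * r) (fls_X_intpow b'))"

definition minus_case :: "'k::field \<Rightarrow> nat \<Rightarrow> 'k fls mat \<Rightarrow> bool" where
  "minus_case im n w \<longleftrightarrow> (\<forall>j<n. perm_of n w j \<noteq> j) \<and>
     (\<exists>q<n. \<exists>a. w $$ (0, q) \<noteq> 0 \<and> w $$ (0, q) = tmono (- im) a)"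

definition cycle_block ::
    "'k::field \<Rightarrow> nat \<Rightarrow> 'k fls mat \<Rightarrow> nat \<times> nat \<Rightarrow> nat \<times> nat \<Rightarrow> 'k fls" where
  "cycle_block im n w = (\<lambda>(j, k).
     let ta = fls_X_intpow (expo n w j); i = fls_const im in
     if minus_case im n w \<and> j = 0
     then block j k i (- ta / 2)
                    1 (- i * ta / 2)
     else block j k (ta / 2)     i
                    (i * ta / 2) 1)"

text \<open>The cycles and pairs occupy pairwise disjoint sets of rows and columns, so adding up
  their blocks amounts to replacing the corresponding submatrices. Here \<open>s\<close> is the chosen square
  root of \<open>t - 1\<close>.\<close>

definition gmat :: "'k::field \<Rightarrow> 'k fps \<Rightarrow> nat \<Rightarrow> 'k fls mat \<Rightarrow> 'k fls mat" where
  "gmat im s n w = mat n n (\<lambda>pq.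
     (\<Sum>j\<in>even_fixed n w. if pq = (j, j) then fls_X_intpow (expo n w j div 2) else 0) +
     (\<Sum>jk\<in>odd_pairs n w. odd_block s n w jk pq) +
     (\<Sum>jk\<in>two_cycles n w. cycle_block im n w jk pq))"

end

theory Submission
  imports Defs
begin

text \<open>
  The map \<open>g \<mapsto> g\<^sup>T g\<close> identifies the double coset of \<open>g\<close> with the class of the symmetric matrix
  \<open>g\<^sup>T g\<close> under congruences \<open>S \<mapsto> b\<^sup>T S b\<close>, \<open>b \<in> B\<close>
  (\<open>congruent_gram_same_double_coset\<close>, \<open>same_double_coset_congruent_gram\<close>). The matrices \<open>g\<^sub>w\<close> are built so
  that \<open>g\<^sub>w\<^sup>T g\<^sub>w = w\<close> and \<open>det g\<^sub>w = 1\<close> (\<open>gmat_iSymAPM\<close>); both are checked one block at a time. It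
  remains to see that every symmetric matrix of determinant \<open>1\<close> is congruent under \<open>B\<close> to exactly one
  element of the index set.

  Existence (\<open>congruent_to_iSymAPM\<close>) is a symmetric Gaussian elimination. The pivot is an entry of
  minimal order, in the topmost row containing one, and leftmost in that row. With this choice the
  clearing operations add only integral multiples of earlier columns to later ones and multiples by
  elements of \<open>t A\<close> of later columns to earlier ones, so they belong to the Iwahori subgroup. A diagonal
  pivot splits off a line, an off-diagonal pivot a hyperbolic plane; making the latter monomial
  requires an integral root of a quadratic equation (\<open>integral_quadratic_root\<close>). Repeating this
  produces a monomial matrix (\<open>congruent_to_monomial\<close>), whose entries are then normalised by a diagonal
  matrix of units, using square roots. The congruences are taken in the Iwahori subgroup of \<open>GL\<^sub>n\<close>, and
  the determinant, which is \<open>1\<close> or \<open>-1\<close> in the end, is corrected by one change of sign.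

  For uniqueness (\<open>congruent_iSymAPM_eq\<close>), comparing orders of entries in \<open>c\<^sup>T w' = w b\<close>, where
  \<open>c = b\<inverse>\<close>, shows that \<open>w\<close> and \<open>w'\<close> have the same underlying permutation and exponents
  (\<open>congruent_monomial\<close>). The only remaining freedom is the sign in the first row when there are no fixed
  points, and it is an invariant because \<open>det b = 1\<close> (\<open>congruent_minus_case\<close>).
\<close>

section \<open>Fractional ideals and the Iwahori subgroup\<close>

text \<open>The fractional ideal \<open>t\<^sup>a A\<close> of the ring \<open>A\<close> of power series. Zero is listed separately because
  its order is \<open>0\<close> by convention.\<close>

definition frac_ideal :: "int \<Rightarrow> 'k::field fls set" where
  "frac_ideal a = {x. x = 0 \<or> a \<le> fls_subdegree x}"

lemma frac_ideal_iff: "x \<in> frac_ideal a \<longleftrightarrow> (\<forall>k<a. fls_nth x k = 0)"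
  unfolding frac_ideal_def
  by (auto intro: fls_subdegree_geI)

lemma frac_ideal_0 [simp]: "0 \<in> frac_ideal a"
  by (simp add: frac_ideal_def)

lemma frac_ideal_1 [simp]: "1 \<in> frac_ideal a \<longleftrightarrow> a \<le> 0"
  by (simp add: frac_ideal_def)

lemma frac_ideal_add: "x \<in> frac_ideal a \<Longrightarrow> y \<in> frac_ideal a \<Longrightarrow> x + y \<in> frac_ideal a"
  by (simp add: frac_ideal_iff)

lemma frac_ideal_uminus: "x \<in> frac_ideal a \<Longrightarrow> - x \<in> frac_ideal a"
  by (simp add: frac_ideal_iff)

lemma frac_ideal_sum: "(\<And>i. i \<in> I \<Longrightarrow> f i \<in> frac_ideal a) \<Longrightarrow> sum f I \<in> frac_ideal a"
  by (induction I rule: infinite_finite_induct) (auto intro: frac_ideal_add)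

lemma frac_ideal_mono: "x \<in> frac_ideal a \<Longrightarrow> b \<le> a \<Longrightarrow> x \<in> frac_ideal b"
  by (auto simp: frac_ideal_def)

lemma frac_ideal_mult: "x \<in> frac_ideal a \<Longrightarrow> y \<in> frac_ideal b \<Longrightarrow> x * y \<in> frac_ideal (a + b)"
  by (cases "x = 0 \<or> y = 0") (auto simp: frac_ideal_def)

lemma frac_ideal_divide:
  "x \<in> frac_ideal a \<Longrightarrow> y \<noteq> 0 \<Longrightarrow> x / y \<in> frac_ideal (a - fls_subdegree y)"
  by (cases "x = 0") (auto simp: frac_ideal_def divide_inverse nonzero_imp_inverse_nonzero)

lemma frac_ideal_mult_left: "x \<in> frac_ideal 0 \<Longrightarrow> y \<in> frac_ideal b \<Longrightarrow> x * y \<in> frac_ideal b"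
  using frac_ideal_mult[of x 0 y b] by simp

lemma frac_ideal_mult_right: "x \<in> frac_ideal a \<Longrightarrow> y \<in> frac_ideal 0 \<Longrightarrow> x * y \<in> frac_ideal a"
  using frac_ideal_mult[of x a y 0] by simp

lemma fps_to_fls_in_frac_ideal [simp]: "fps_to_fls f \<in> frac_ideal 0"
  by (simp add: frac_ideal_def fls_subdegree_fls_to_fps_gt0)

lemma fps_to_fls_regpart: "x \<in> frac_ideal 0 \<Longrightarrow> fps_to_fls (fls_regpart x) = x"
  by (auto simp: frac_ideal_def)

lemma nth0_mult:
  assumes "x \<in> frac_ideal 0" "y \<in> frac_ideal 0"
  shows "fls_nth (x * y) 0 = fls_nth x 0 * fls_nth y 0"
proof -
  have "x * y = fps_to_fls (fls_regpart x * fls_regpart y)"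
    using assms by (simp add: fls_times_fps_to_fls fps_to_fls_regpart)
  also have "fls_nth \<dots> 0 = fls_nth x 0 * fls_nth y 0"
    by simp
  finally show ?thesis .
qed

lemma nth0_eq_0: "x \<in> frac_ideal 1 \<Longrightarrow> fls_nth x 0 = 0"
  by (simp add: frac_ideal_iff)

lemma mult_mat_nth:
  assumes "a \<in> carrier_mat n n" "b \<in> carrier_mat n n" "i < n" "j < n"
  shows "(a * b) $$ (i, j) = (\<Sum>k<n. a $$ (i, k) * b $$ (k, j))"
  using assms by (auto simp: scalar_prod_def atLeast0LessThan intro!: sum.cong)

text \<open>The Iwahori subgroup of \<open>GL\<^sub>n\<close>: matrices over \<open>A\<close> whose reduction at \<open>t = 0\<close> is upper
  triangular and invertible. No condition is put on the determinant, so that congruences can be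
  composed before the determinant is normalised.\<close>

definition GL_Iwahori :: "nat \<Rightarrow> 'k::field fls mat set" where
  "GL_Iwahori n = {b \<in> carrier_mat n n.
     (\<forall>i<n. \<forall>j<n. b $$ (i, j) \<in> frac_ideal (if j < i then 1 else 0)) \<and>
     (\<forall>i<n. fls_nth (b $$ (i, i)) 0 \<noteq> 0)}"

lemma GL_IwahoriI:
  assumes "b \<in> carrier_mat n n"
    and "\<And>i j. j < i \<Longrightarrow> i < n \<Longrightarrow> b $$ (i, j) \<in> frac_ideal 1"
    and "\<And>i j. i < j \<Longrightarrow> j < n \<Longrightarrow> b $$ (i, j) \<in> frac_ideal 0"
    and "\<And>i. i < n \<Longrightarrow> b $$ (i, i) \<in> frac_ideal 0 \<and> fls_nth (b $$ (i, i)) 0 \<noteq> 0"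
  shows "b \<in> GL_Iwahori n"
proof -
  have "b $$ (i, j) \<in> frac_ideal (if j < i then 1 else 0)" if "i < n" "j < n" for i j
    using assms that by (cases i j rule: linorder_cases) auto
  with assms show ?thesis by (simp add: GL_Iwahori_def)
qed

lemma GL_IwahoriD:
  assumes "b \<in> GL_Iwahori n"
  shows "b \<in> carrier_mat n n"
    and "\<And>i j. i < n \<Longrightarrow> j < n \<Longrightarrow> b $$ (i, j) \<in> frac_ideal 0"
    and "\<And>i j. j < i \<Longrightarrow> i < n \<Longrightarrow> b $$ (i, j) \<in> frac_ideal 1"
    and "\<And>i. i < n \<Longrightarrow> fls_nth (b $$ (i, i)) 0 \<noteq> 0"
proof -
  have *: "b $$ (i, j) \<in> frac_ideal (if j < i then 1 else 0)" if "i < n" "j < n" for i j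
    using assms that by (simp add: GL_Iwahori_def)
  show "b $$ (i, j) \<in> frac_ideal 0" if "i < n" "j < n" for i j
    using *[OF that] by (auto split: if_splits intro: frac_ideal_mono)
  show "b $$ (i, j) \<in> frac_ideal 1" if "j < i" "i < n" for i j
    using *[of i j] that by simp
qed (use assms in \<open>auto simp: GL_Iwahori_def\<close>)

lemma GL_Iwahori_diag_mult:
  assumes a: "a \<in> GL_Iwahori n" and b: "b \<in> GL_Iwahori n" and i: "i < n"
  shows "fls_nth ((a * b) $$ (i, i)) 0 = fls_nth (a $$ (i, i)) 0 * fls_nth (b $$ (i, i)) 0"
proof -
  note aD = GL_IwahoriD[OF a] and bD = GL_IwahoriD[OF b]
  have z: "fls_nth (a $$ (i, k) * b $$ (k, i)) 0 = 0" if "k < n" "k \<noteq> i" for k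
  proof (cases "k < i")
    case True
    then show ?thesis using aD(3)[of k i] bD(2)[of k i] i that
      by (intro nth0_eq_0 frac_ideal_mult_right)
  next
    case False
    then show ?thesis using aD(2)[of i k] bD(3)[of i k] i that
      by (intro nth0_eq_0 frac_ideal_mult_left) auto
  qed
  have "fls_nth ((a * b) $$ (i, i)) 0 = (\<Sum>k<n. fls_nth (a $$ (i, k) * b $$ (k, i)) 0)"
    using mult_mat_nth[OF aD(1) bD(1) i i] by (simp add: fls_nth_sum)
  also have "\<dots> = (\<Sum>k\<in>{i}. fls_nth (a $$ (i, k) * b $$ (k, i)) 0)"
    using i z by (intro sum.mono_neutral_right) auto
  also have "\<dots> = fls_nth (a $$ (i, i)) 0 * fls_nth (b $$ (i, i)) 0"
    using aD(2) bD(2) i by (simp add: nth0_mult)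
  finally show ?thesis .
qed

lemma GL_Iwahori_mult:
  assumes a: "a \<in> GL_Iwahori n" and b: "b \<in> GL_Iwahori n"
  shows "a * b \<in> GL_Iwahori n"
proof -
  note aD = GL_IwahoriD[OF a] and bD = GL_IwahoriD[OF b]
  have in0: "(a * b) $$ (i, j) \<in> frac_ideal 0" if "i < n" "j < n" for i j
    unfolding mult_mat_nth[OF aD(1) bD(1) that]
    using aD(2) bD(2) that by (intro frac_ideal_sum frac_ideal_mult_left) auto
  have in1: "(a * b) $$ (i, j) \<in> frac_ideal 1" if "j < i" "i < n" for i j
  proof -
    have "a $$ (i, k) * b $$ (k, j) \<in> frac_ideal 1" if "k < n" for k
    proof (cases "k < i")
      case True
      with aD(3)[of k i] bD(2)[of k j] that \<open>j < i\<close> \<open>i < n\<close> show ?thesis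
        by (intro frac_ideal_mult_right) auto
    next
      case False
      with aD(2)[of i k] bD(3)[of j k] that \<open>j < i\<close> \<open>i < n\<close> show ?thesis
        by (intro frac_ideal_mult_left) auto
    qed
    then show ?thesis
      using mult_mat_nth[OF aD(1) bD(1), of i j] that by (auto intro!: frac_ideal_sum)
  qed
  show ?thesis
  proof (rule GL_IwahoriI)
    show "a * b \<in> carrier_mat n n" using aD(1) bD(1) by simp
    show "(a * b) $$ (i, i) \<in> frac_ideal 0 \<and> fls_nth ((a * b) $$ (i, i)) 0 \<noteq> 0"
      if "i < n" for i
      using in0[OF that that] GL_Iwahori_diag_mult[OF a b that] aD(4)[OF that] bD(4)[OF that]
      by simp
  qed (use in0 in1 in auto)
qed

lemma fps_to_fls_comm_ring_hom: "comm_ring_hom (fps_to_fls :: 'k::field fps \<Rightarrow> 'k fls)"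
  by unfold_locales (simp_all add: fls_times_fps_to_fls)

lemma fps_nth0_comm_ring_hom: "comm_ring_hom (\<lambda>f :: 'k::field fps. fps_nth f 0)"
  by unfold_locales simp_all

lemma map_regpart_mat:
  assumes "b \<in> carrier_mat n n"
    and "\<And>i j. i < n \<Longrightarrow> j < n \<Longrightarrow> b $$ (i, j) \<in> frac_ideal 0"
  shows "map_mat fps_to_fls (map_mat fls_regpart b) = b"
  using assms by (intro eq_matI) (auto simp: fps_to_fls_regpart)

text \<open>Modulo \<open>t\<close> the matrix is upper triangular, so its determinant reduces to the product of the
  diagonal.\<close>

lemma GL_Iwahori_det:
  assumes "b \<in> GL_Iwahori n"
  shows "det b \<in> frac_ideal 0" and "fls_nth (det b) 0 = (\<Prod>i<n. fls_nth (b $$ (i, i)) 0)"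
proof -
  note bD = GL_IwahoriD[OF assms]
  define c where "c = map_mat fls_regpart b"
  define d where "d = map_mat (\<lambda>f. fps_nth f 0) c"
  have cc: "c \<in> carrier_mat n n" and dc: "d \<in> carrier_mat n n"
    using bD(1) by (auto simp: c_def d_def)
  have b: "b = map_mat fps_to_fls c"
    unfolding c_def using map_regpart_mat[of b n] bD by simp
  have det: "det b = fps_to_fls (det c)"
    unfolding b by (rule comm_ring_hom.hom_det[OF fps_to_fls_comm_ring_hom])
  then show "det b \<in> frac_ideal 0" by simp
  have dij: "d $$ (i, j) = fls_nth (b $$ (i, j)) 0" if "i < n" "j < n" for i j
    using bD(1) that by (simp add: d_def c_def)
  have ut: "upper_triangular d"
    using dc bD(3) dij by (intro upper_triangularI) (auto simp: nth0_eq_0)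
  have "fls_nth (det b) 0 = fps_nth (det c) 0"
    by (simp add: det)
  also have "\<dots> = det d"
    unfolding d_def by (rule comm_ring_hom.hom_det[OF fps_nth0_comm_ring_hom, symmetric])
  also have "\<dots> = (\<Prod>i<n. d $$ (i, i))"
    using det_upper_triangular[OF ut dc] dc
    by (simp add: diag_mat_def prod.list_conv_set_nth atLeast0LessThan)
  also have "\<dots> = (\<Prod>i<n. fls_nth (b $$ (i, i)) 0)"
    using dij by simp
  finally show "fls_nth (det b) 0 = (\<Prod>i<n. fls_nth (b $$ (i, i)) 0)" .
qed

lemma GL_Iwahori_det_nonzero: "b \<in> GL_Iwahori n \<Longrightarrow> det b \<noteq> 0"
  using GL_Iwahori_det(2)[of b n] GL_IwahoriD(4)[of b n]
  by (metis (no_types, lifting) finite_lessThan fls_zero_nth lessThan_iff prod_zero_iff)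

lemma Iwahori_eq: "(Iwahori n :: 'k::field fls mat set) = GL_Iwahori n \<inter> SL n"
proof (intro equalityI subsetI)
  fix b :: "'k fls mat" assume "b \<in> Iwahori n"
  then obtain c where c: "c \<in> carrier_mat n n" "det c = 1"
    and ut: "upper_triangular (map_mat (\<lambda>f. fps_nth f 0) c)" and b: "b = map_mat fps_to_fls c"
    by (auto simp: Iwahori_def SL_def)
  define d where "d = map_mat (\<lambda>f. fps_nth f 0) c"
  have d: "d \<in> carrier_mat n n" using c by (simp add: d_def)
  have "det d = 1"
    unfolding d_def using comm_ring_hom.hom_det[OF fps_nth0_comm_ring_hom, of c] c by simp
  moreover have "det d = (\<Prod>i<n. d $$ (i, i))"
    using det_upper_triangular[OF _ d] ut d
    by (simp add: d_def[symmetric] diag_mat_def prod.list_conv_set_nth atLeast0LessThan)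
  ultimately have "(\<Prod>i<n. d $$ (i, i)) \<noteq> 0" by simp
  then have "fps_nth (c $$ (i, i)) 0 \<noteq> 0" if "i < n" for i
    using that c by (auto simp: d_def)
  moreover have "fps_to_fls (c $$ (i, j)) \<in> frac_ideal 1" if "j < i" "i < n" for i j
  proof -
    have "fps_nth (c $$ (i, j)) 0 = 0"
      using upper_triangularD[OF ut that(1)] that c by simp
    then show ?thesis by (auto simp: frac_ideal_iff)
  qed
  ultimately have "b \<in> GL_Iwahori n"
    using c by (intro GL_IwahoriI) (auto simp: b)
  moreover have "det b = 1"
    unfolding b using comm_ring_hom.hom_det[OF fps_to_fls_comm_ring_hom, of c] c by simp
  ultimately show "b \<in> GL_Iwahori n \<inter> SL n"
    using b c by (simp add: SL_def)
next
  fix b :: "'k fls mat" assume "b \<in> GL_Iwahori n \<inter> SL n"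
  then have b: "b \<in> GL_Iwahori n" and det: "det b = 1" by (auto simp: SL_def)
  note bD = GL_IwahoriD[OF b]
  define c where "c = map_mat fls_regpart b"
  have bc: "b = map_mat fps_to_fls c"
    unfolding c_def using map_regpart_mat[of b n] bD by simp
  have "fps_to_fls (det c) = 1"
    using det unfolding bc by (metis comm_ring_hom.hom_det[OF fps_to_fls_comm_ring_hom])
  then have "c \<in> SL n" using bD(1) by (simp add: SL_def c_def)
  moreover have "upper_triangular (map_mat (\<lambda>f. fps_nth f 0) c)"
    using bD by (intro upper_triangularI) (auto simp: c_def nth0_eq_0)
  ultimately show "b \<in> Iwahori n" using bc by (auto simp: Iwahori_def)
qed

lemma one_in_GL_Iwahori: "1\<^sub>m n \<in> GL_Iwahori n"
  by (intro GL_IwahoriI) auto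

lemma one_in_Iwahori: "1\<^sub>m n \<in> Iwahori n"
  by (simp add: Iwahori_eq SL_def one_in_GL_Iwahori)

lemma Iwahori_mult: "a \<in> Iwahori n \<Longrightarrow> b \<in> Iwahori n \<Longrightarrow> a * b \<in> Iwahori n"
  unfolding Iwahori_eq by (auto simp: GL_Iwahori_mult SL_def det_mult)

lemma upper_triangular_left_inverse:
  fixes c d :: "'a::field mat"
  assumes c: "c \<in> carrier_mat n n" and d: "d \<in> carrier_mat n n"
    and cd: "c * d = 1\<^sub>m n" and ut: "upper_triangular d"
  shows "upper_triangular c"
proof (rule upper_triangularI)
  fix i j assume ji: "j < i" and "i < dim_row c"
  then have i: "i < n" using c by simp
  have "det c * det d = 1"
    using det_mult[OF c d] cd by simp
  then have "det d \<noteq> 0" by auto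
  then have diag: "d $$ (k, k) \<noteq> 0" if "k < n" for k
    using det_upper_triangular[OF ut d] d that
    by (auto simp: diag_mat_def prod.list_conv_set_nth)
  show "c $$ (i, j) = 0"
    using ji
  proof (induction j rule: less_induct)
    case (less j)
    have j: "j < n" using less.prems i by simp
    have z: "c $$ (i, k) * d $$ (k, j) = 0" if "k < n" "k \<noteq> j" for k
      using less that upper_triangularD[OF ut, of j k] d by (cases "k < j") auto
    have "0 = (c * d) $$ (i, j)"
      using cd i j less.prems by simp
    also have "\<dots> = (\<Sum>k<n. c $$ (i, k) * d $$ (k, j))"
      by (rule mult_mat_nth[OF c d i j])
    also have "\<dots> = (\<Sum>k\<in>{j}. c $$ (i, k) * d $$ (k, j))"
      using j z by (intro sum.mono_neutral_right) auto
    finally show ?case using diag[OF j] by simp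
  qed
qed

lemma Iwahori_inverse:
  fixes b :: "'a::field fls mat"
  assumes "b \<in> Iwahori n"
  obtains c where "c \<in> Iwahori n" "c * b = 1\<^sub>m n" "b * c = 1\<^sub>m n"
proof -
  from assms obtain a :: "'a fps mat" where a: "a \<in> carrier_mat n n" "det a = 1"
    and ut: "upper_triangular (map_mat (\<lambda>f. fps_nth f 0) a)" and b: "b = map_mat fps_to_fls a"
    by (auto simp: Iwahori_def SL_def)
  define c where "c = adj_mat a"
  have c: "c \<in> carrier_mat n n" and ac: "a * c = 1\<^sub>m n" and ca: "c * a = 1\<^sub>m n"
    using adj_mat[OF a(1)] a(2) by (auto simp: c_def)
  have "det c = 1"
    using ca det_mult[OF c a(1)] a by simp
  let ?h = "map_mat (\<lambda>f :: 'a fps. fps_nth f 0)"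
  interpret h: comm_ring_hom "\<lambda>f :: 'a fps. fps_nth f 0" by (rule fps_nth0_comm_ring_hom)
  interpret f: comm_ring_hom "fps_to_fls :: 'a fps \<Rightarrow> 'a fls" by (rule fps_to_fls_comm_ring_hom)
  have "?h c * ?h a = 1\<^sub>m n"
    unfolding h.mat_hom_mult[OF c a(1), symmetric] ca by (rule h.mat_hom_one)
  then have "upper_triangular (?h c)"
    by (rule upper_triangular_left_inverse[of _ n "?h a", rotated 2, OF _ ut])
      (use a c in simp_all)
  then have "map_mat fps_to_fls c \<in> Iwahori n"
    using c \<open>det c = 1\<close> by (auto simp: Iwahori_def SL_def)
  moreover have "map_mat fps_to_fls c * b = 1\<^sub>m n"
    unfolding b f.mat_hom_mult[OF c a(1), symmetric] ca by (rule f.mat_hom_one)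
  moreover have "b * map_mat fps_to_fls c = 1\<^sub>m n"
    unfolding b f.mat_hom_mult[OF a(1) c, symmetric] ac by (rule f.mat_hom_one)
  ultimately show ?thesis using that by blast
qed

section \<open>Square roots of power series\<close>

text \<open>The coefficients of the square root of \<open>f\<close> with constant term \<open>c\<close>, where \<open>c\<^sup>2\<close> is the constant
  term of \<open>f\<close>. Only \<open>2 c \<noteq> 0\<close> is needed, so that odd positive characteristic is covered.\<close>

fun sqrt_coeff :: "'k::field fps \<Rightarrow> 'k \<Rightarrow> nat \<Rightarrow> 'k" where
  "sqrt_coeff f c 0 = c"
| "sqrt_coeff f c (Suc m) =
     (fps_nth f (Suc m) - (\<Sum>i\<in>{1..m}. sqrt_coeff f c i * sqrt_coeff f c (Suc m - i))) / (2 * c)"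

declare sqrt_coeff.simps(2) [simp del]

lemma fps_sqrt_exists:
  fixes f :: "'k::field fps"
  assumes two: "(2::'k) \<noteq> 0" and c: "c ^ 2 = fps_nth f 0" "c \<noteq> 0"
  shows "\<exists>g. g ^ 2 = f \<and> fps_nth g 0 = c"
proof -
  let ?g = "sqrt_coeff f c"
  have "fps_nth (Abs_fps ?g ^ 2) m = fps_nth f m" for m
  proof (cases m)
    case 0
    then show ?thesis using c by (simp add: power2_eq_square fps_mult_nth)
  next
    case (Suc k)
    have "fps_nth (Abs_fps ?g ^ 2) m = (\<Sum>i=0..Suc k. ?g i * ?g (Suc k - i))"
      by (simp add: Suc power2_eq_square fps_mult_nth)
    also have "\<dots> = ?g 0 * ?g (Suc k) + (\<Sum>i\<in>{1..k}. ?g i * ?g (Suc k - i)) + ?g (Suc k) * ?g 0"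
      by (simp add: sum.atLeast_Suc_atMost)
    also have "\<dots> = fps_nth f m"
      using two c(2) by (simp add: Suc sqrt_coeff.simps(2) field_simps)
    finally show ?thesis .
  qed
  then have "Abs_fps ?g ^ 2 = f" by (simp add: fps_eq_iff)
  then show ?thesis by (intro exI[of _ "Abs_fps ?g"]) simp
qed

text \<open>Since \<open>a\<close> lies one step deeper in the filtration than the coefficient \<open>b\<close>, exactly one root of
  the quadratic equation is integral. It is written as \<open>d / (b * (1 + h))\<close>, with \<open>h\<close> the square root of
  \<open>1 - a * d / b\<^sup>2\<close> that has constant term \<open>1\<close>.\<close>

lemma integral_quadratic_root:
  fixes a b d :: "'k::field fls"
  assumes two: "(2::'k) \<noteq> 0" and b: "b \<noteq> 0"
    and a: "a \<in> frac_ideal (fls_subdegree b + 1)" and d: "d \<in> frac_ideal (fls_subdegree b)"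
  shows "\<exists>f \<in> frac_ideal 0. d - 2 * f * b + f ^ 2 * a = 0"
proof -
  let ?v = "fls_subdegree b"
  define z where "z = a * d / b ^ 2"
  have "a * d \<in> frac_ideal (?v + 1 + ?v)" by (rule frac_ideal_mult[OF a d])
  from frac_ideal_divide[OF this, of "b ^ 2"] b have z: "z \<in> frac_ideal 1"
    by (simp add: z_def power2_eq_square)
  then have z0: "z \<in> frac_ideal 0" by (rule frac_ideal_mono) simp
  obtain h where h: "h ^ 2 = 1 - fls_regpart z" and h0: "fps_nth h 0 = 1"
    using fps_sqrt_exists[OF two, of 1 "1 - fls_regpart z"] nth0_eq_0[OF z] by auto
  define r where "r = fps_to_fls h"
  have r2: "r ^ 2 = 1 - z"
    unfolding r_def fps_to_fls_power[symmetric] h by (simp add: fps_to_fls_regpart[OF z0])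
  have "fls_nth (1 + r) 0 = 2" by (simp add: r_def h0)
  with two have r0: "1 + r \<noteq> 0" and sd: "fls_subdegree (1 + r) = 0"
    by (auto intro!: fls_subdegree_eqI fls_nonzeroI[of _ 0] simp: r_def)
  define f where "f = d / (b * (1 + r))"
  have "f \<in> frac_ideal 0"
    unfolding f_def using frac_ideal_divide[OF d, of "b * (1 + r)"] b r0 sd by simp
  moreover have "d - 2 * f * b + f ^ 2 * a = 0"
  proof -
    have ad: "a * d = (1 - r) * (1 + r) * b ^ 2"
      using r2 b by (simp add: z_def field_simps power2_eq_square)
    have f: "d = f * (b * (1 + r))"
      using b r0 by (simp add: f_def)
    have "(d - 2 * f * b + f ^ 2 * a) * (1 + r) * b =
        f * b * (b * (1 + r) * (1 + r) - 2 * b * (1 + r)) + f * (a * (f * (b * (1 + r))))"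
      by (subst f) (simp add: algebra_simps power2_eq_square)
    also have "\<dots> = 0"
      unfolding f[symmetric] ad by (simp add: algebra_simps power2_eq_square)
    finally show ?thesis using b r0 by simp
  qed
  ultimately show ?thesis by blast
qed

section \<open>Reduction of symmetric matrices to monomial form\<close>

lemma congruence_symmetric:
  fixes S b :: "'a::comm_ring_1 mat"
  assumes "b \<in> carrier_mat n n" "S \<in> carrier_mat n n" "S\<^sup>T = S"
  shows "(b\<^sup>T * S * b)\<^sup>T = b\<^sup>T * S * b"
proof -
  have "(b\<^sup>T * S * b)\<^sup>T = b\<^sup>T * (b\<^sup>T * S)\<^sup>T"
    using assms by (subst transpose_mult[of _ n n _ n]) auto
  also have "\<dots> = b\<^sup>T * (S * b)"
    using assms by (subst transpose_mult[of _ n n _ n]) auto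
  also have "\<dots> = b\<^sup>T * S * b"
    using assms by (subst assoc_mult_mat[of _ n n _ n _ n]) auto
  finally show ?thesis .
qed

lemma congruence_congruence:
  fixes S b c :: "'a::comm_ring_1 mat"
  assumes b: "b \<in> carrier_mat n n" and c: "c \<in> carrier_mat n n" and S: "S \<in> carrier_mat n n"
  shows "c\<^sup>T * (b\<^sup>T * S * b) * c = (b * c)\<^sup>T * S * (b * c)"
proof -
  have "(b * c)\<^sup>T * S * (b * c) = c\<^sup>T * b\<^sup>T * S * (b * c)"
    by (simp add: transpose_mult[OF b c])
  also have "\<dots> = c\<^sup>T * b\<^sup>T * S * b * c"
    using assms by (intro assoc_mult_mat[symmetric, of _ n n _ n _ n]) auto
  also have "c\<^sup>T * b\<^sup>T * S = c\<^sup>T * (b\<^sup>T * S)"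
    using assms by (intro assoc_mult_mat[of _ n n _ n _ n]) auto
  also have "c\<^sup>T * (b\<^sup>T * S) * b = c\<^sup>T * (b\<^sup>T * S * b)"
    using assms by (intro assoc_mult_mat[of _ n n _ n _ n]) auto
  finally show ?thesis by simp
qed

lemma det_congruence:
  fixes S b :: "'a::comm_ring_1 mat"
  assumes b: "b \<in> carrier_mat n n" and S: "S \<in> carrier_mat n n"
  shows "det (b\<^sup>T * S * b) = det b ^ 2 * det S"
proof -
  have "det (b\<^sup>T * S * b) = det b\<^sup>T * det S * det b"
    using b S by (subst det_mult[of _ n], simp, simp, subst det_mult[of _ n], auto)
  then show ?thesis using det_transpose[OF b] by (simp add: power2_eq_square mult_ac)
qed

lemma congruence_nth:
  fixes b S :: "'a::comm_ring_1 mat"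
  assumes b: "b \<in> carrier_mat n n" and S: "S \<in> carrier_mat n n" and ij: "i < n" "j < n"
  shows "(b\<^sup>T * S * b) $$ (i, j) = (\<Sum>k<n. b $$ (k, i) * (\<Sum>l<n. b $$ (l, j) * S $$ (k, l)))"
proof -
  have "b\<^sup>T * S * b = b\<^sup>T * (S * b)"
    using b S by (intro assoc_mult_mat[of _ n n _ n _ n]) auto
  also have "\<dots> $$ (i, j) = (\<Sum>k<n. b\<^sup>T $$ (i, k) * (S * b) $$ (k, j))"
    using b S ij by (intro mult_mat_nth) auto
  also have "\<dots> = (\<Sum>k<n. b $$ (k, i) * (\<Sum>l<n. b $$ (l, j) * S $$ (k, l)))"
    using b S ij by (intro sum.cong refl)
      (simp add: mult_mat_nth[OF S b] mult.commute del: index_mult_mat)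
  finally show ?thesis .
qed

lemma symmetric_nth: "S\<^sup>T = S \<Longrightarrow> S \<in> carrier_mat n n \<Longrightarrow> i < n \<Longrightarrow> j < n \<Longrightarrow> S $$ (i, j) = S $$ (j, i)"
  by (metis carrier_matD index_transpose_mat(1))

text \<open>The matrix whose \<open>j\<close>-th column is \<open>e\<^sub>j + x\<^sub>j e\<^sub>p + y\<^sub>j e\<^sub>q\<close>.\<close>

definition shear :: "nat \<Rightarrow> nat \<Rightarrow> nat \<Rightarrow> (nat \<Rightarrow> 'a::comm_ring_1) \<Rightarrow> (nat \<Rightarrow> 'a) \<Rightarrow> 'a mat" where
  "shear n p q x y = mat n n (\<lambda>(i, j).
     (if i = j then 1 else 0) + (if i = p then x j else 0) + (if i = q then y j else 0))"

lemma shear_carrier [simp]: "shear n p q x y \<in> carrier_mat n n"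
  by (simp add: shear_def)

lemma shear_congruence_nth:
  fixes S :: "'a::comm_ring_1 mat" and x y :: "nat \<Rightarrow> 'a"
  assumes S: "S \<in> carrier_mat n n" and n: "p < n" "q < n" "i < n" "j < n"
  defines "u \<equiv> \<lambda>i j. S $$ (i, j) + x j * S $$ (i, p) + y j * S $$ (i, q)"
  shows "((shear n p q x y)\<^sup>T * S * shear n p q x y) $$ (i, j) = u i j + x i * u p j + y i * u q j"
proof -
  have *: "(\<Sum>k<n. shear n p q x y $$ (k, i) * h k) = h i + x i * h p + y i * h q"
    if "i < n" for i and h :: "nat \<Rightarrow> 'a"
  proof -
    have "(\<Sum>k<n. shear n p q x y $$ (k, i) * h k) =
        (\<Sum>k<n. (if k = i then h k else 0) + (if k = p then x i * h k else 0) + (if k = q then y i * h k else 0))"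
      using that by (intro sum.cong) (auto simp: shear_def algebra_simps)
    also have "\<dots> = h i + x i * h p + y i * h q"
      using n that by (simp add: sum.distrib)
    finally show ?thesis .
  qed
  show ?thesis
    unfolding congruence_nth[OF shear_carrier S n(3,4)] *[OF n(4)] *[OF n(3)] u_def by simp
qed

lemma shear_in_GL_Iwahori:
  assumes "x p = 0" "y q = 0"
    and "\<And>j. j < n \<Longrightarrow> x j \<in> frac_ideal (if j < p then 1 else 0)"
    and "\<And>j. j < n \<Longrightarrow> y j \<in> frac_ideal (if j < q then 1 else 0)"
  shows "shear n p q x y \<in> GL_Iwahori n"
proof (rule GL_IwahoriI)
  have 0: "x j \<in> frac_ideal 0" "y j \<in> frac_ideal 0" if "j < n" for j
    using assms(3,4)[OF that] by (auto split: if_splits intro: frac_ideal_mono)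
  show "shear n p q x y $$ (i, j) \<in> frac_ideal 1" if "j < i" "i < n" for i j
    using assms(3,4)[of j] that by (auto simp: shear_def intro!: frac_ideal_add)
  show "shear n p q x y $$ (i, j) \<in> frac_ideal 0" if "i < j" "j < n" for i j
    using 0 that by (auto simp: shear_def intro!: frac_ideal_add)
  show "shear n p q x y $$ (i, i) \<in> frac_ideal 0 \<and> fls_nth (shear n p q x y $$ (i, i)) 0 \<noteq> 0"
    if "i < n" for i
    using assms(1,2) that 
    by (cases "i = p"; cases "i = q") (auto simp: shear_def)
qed simp

text \<open>The basis vectors outside \<open>I\<close> already span an orthogonal summand on which the form is
  monomial.\<close>

definition monomial_off :: "nat \<Rightarrow> nat set \<Rightarrow> 'a::zero mat \<Rightarrow> bool" where
  "monomial_off n I S \<longleftrightarrow> (\<forall>p<n. p \<notin> I \<longrightarrow>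
     (\<exists>q<n. q \<notin> I \<and> S $$ (p, q) \<noteq> 0 \<and> (\<forall>j<n. j \<noteq> q \<longrightarrow> S $$ (p, j) = 0)))"

text \<open>A pivot: a non-zero entry of minimal order in the rows and columns of \<open>I\<close>, chosen in the topmost
  row containing such an entry, and leftmost in that row. This choice makes the clearing operations
  belong to the Iwahori subgroup.\<close>

definition pivot :: "nat set \<Rightarrow> 'k::field fls mat \<Rightarrow> nat \<Rightarrow> nat \<Rightarrow> bool" where
  "pivot I S p q \<longleftrightarrow> p \<in> I \<and> q \<in> I \<and> S $$ (p, q) \<noteq> 0 \<and>
     (\<forall>i\<in>I. \<forall>j\<in>I. S $$ (i, j) \<in> frac_ideal (fls_subdegree (S $$ (p, q)))) \<and>
     (\<forall>i\<in>I. \<forall>j\<in>I. i < p \<longrightarrow> S $$ (i, j) \<in> frac_ideal (fls_subdegree (S $$ (p, q)) + 1)) \<and>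
     (\<forall>j\<in>I. j < q \<longrightarrow> S $$ (p, j) \<in> frac_ideal (fls_subdegree (S $$ (p, q)) + 1))"

lemma pivot_exists:
  assumes "finite I" and "i0 \<in> I" "j0 \<in> I" "S $$ (i0, j0) \<noteq> 0"
  shows "\<exists>p q. pivot I S p q"
proof -
  define V where "V = (\<lambda>(i, j). fls_subdegree (S $$ (i, j))) ` {(i, j). i \<in> I \<and> j \<in> I \<and> S $$ (i, j) \<noteq> 0}"
  have "finite {(i, j). i \<in> I \<and> j \<in> I \<and> S $$ (i, j) \<noteq> 0}"
    by (rule finite_subset[of _ "I \<times> I"]) (use assms in auto)
  then have finV: "finite V" by (simp add: V_def)
  have "V \<noteq> {}" using assms by (auto simp: V_def)
  define v where "v = Min V"
  have "v \<in> V" unfolding v_def using finV \<open>V \<noteq> {}\<close> by (rule Min_in)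
  have Vv: "v \<le> w" if "w \<in> V" for w unfolding v_def using finV that by (rule Min_le)
  define R where "R = (\<lambda>i j. j \<in> I \<and> S $$ (i, j) \<noteq> 0 \<and> fls_subdegree (S $$ (i, j)) = v)"
  define p where "p = (LEAST i. i \<in> I \<and> (\<exists>j. R i j))"
  have "\<exists>i. i \<in> I \<and> (\<exists>j. R i j)" using \<open>v \<in> V\<close> by (auto simp: V_def R_def)
  then have p: "p \<in> I \<and> (\<exists>j. R p j)" unfolding p_def by (rule LeastI_ex)
  define q where "q = (LEAST j. R p j)"
  have q: "R p q" unfolding q_def using p by (auto intro: LeastI_ex)
  have le: "v \<le> fls_subdegree (S $$ (i, j))" if "i \<in> I" "j \<in> I" "S $$ (i, j) \<noteq> 0" for i j
    using that by (auto intro!: Vv simp: V_def)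
  have lt: "v + 1 \<le> fls_subdegree (S $$ (i, j))" if "i \<in> I" "j \<in> I" "S $$ (i, j) \<noteq> 0" "\<not> R i j" for i j
    using le[OF that(1-3)] that by (auto simp: R_def)
  have 1: "S $$ (i, j) \<in> frac_ideal (v + 1)" if "i \<in> I" "j \<in> I" "i < p" for i j
    using not_less_Least[of i "\<lambda>i. i \<in> I \<and> (\<exists>j. R i j)"] lt[of i j] that
    by (auto simp: frac_ideal_def p_def[symmetric])
  have 2: "S $$ (p, j) \<in> frac_ideal (v + 1)" if "j \<in> I" "j < q" for j
    using not_less_Least[of j "R p"] lt[of p j] that p
    by (auto simp: frac_ideal_def q_def[symmetric])
  have "pivot I S p q"
    using p q le 1 2 by (auto simp: pivot_def R_def frac_ideal_def)
  then show ?thesis by blast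
qed

lemma monomial_off_zero:
  assumes "monomial_off n I S" "S \<in> carrier_mat n n" "S\<^sup>T = S" "I \<subseteq> {..<n}" "p \<in> I" "i < n" "i \<notin> I"
  shows "S $$ (i, p) = 0" "S $$ (p, i) = 0"
proof -
  show "S $$ (i, p) = 0"
    using assms unfolding monomial_off_def by (metis lessThan_iff subsetD)
  then show "S $$ (p, i) = 0"
    using symmetric_nth[of S n i p] assms by auto
qed

lemma pivot_le:
  assumes "pivot I S p q" "S \<in> carrier_mat n n" "S\<^sup>T = S" "I \<subseteq> {..<n}"
  shows "p \<le> q"
proof (rule ccontr)
  assume "\<not> p \<le> q"
  then have "S $$ (q, p) \<in> frac_ideal (fls_subdegree (S $$ (p, q)) + 1)"
    using assms(1) by (auto simp: pivot_def)
  moreover have "S $$ (q, p) = S $$ (p, q)"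
    using assms by (intro symmetric_nth) (auto simp: pivot_def)
  ultimately show False
    using assms(1) by (auto simp: frac_ideal_def pivot_def)
qed

text \<open>A diagonal pivot splits off one basis vector: multiples of column \<open>p\<close> clear the rest of its row.\<close>

lemma clear_diagonal_pivot:
  assumes S: "S \<in> carrier_mat n n" "S\<^sup>T = S" and I: "I \<subseteq> {..<n}"
    and mo: "monomial_off n I S" and pv: "pivot I S p p"
  shows "\<exists>b\<in>GL_Iwahori n. monomial_off n (I - {p}) (b\<^sup>T * S * b)"
proof -
  define v where "v = fls_subdegree (S $$ (p, p))"
  have pI: "p \<in> I" and pp: "S $$ (p, p) \<noteq> 0" and pn: "p < n"
    and Sv: "\<And>j. j \<in> I \<Longrightarrow> S $$ (p, j) \<in> frac_ideal v"
    and Sv1: "\<And>j. j \<in> I \<Longrightarrow> j < p \<Longrightarrow> S $$ (p, j) \<in> frac_ideal (v + 1)"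
    using pv I by (auto simp: pivot_def v_def)
  note z = monomial_off_zero[OF mo S I pI]
  define x where "x = (\<lambda>j. if j = p then 0 else - (S $$ (p, j) / S $$ (p, p)))"
  define b where "b = shear n p p x (\<lambda>_. 0)"
  have x: "x j \<in> frac_ideal (if j < p then 1 else 0)" if "j < n" for j
  proof (cases "j \<in> I")
    case True
    show ?thesis
      using frac_ideal_divide[OF Sv1[OF True] pp] frac_ideal_divide[OF Sv[OF True] pp]
      by (auto simp: x_def v_def[symmetric] intro!: frac_ideal_uminus)
  next
    case False
    then show ?thesis using z[OF that] by (simp add: x_def)
  qed
  have "b \<in> GL_Iwahori n"
    unfolding b_def using x by (intro shear_in_GL_Iwahori) (auto simp: x_def)
  moreover have "monomial_off n (I - {p}) (b\<^sup>T * S * b)"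
  proof -
    have T: "(b\<^sup>T * S * b) $$ (i, j) = S $$ (i, j) + x j * S $$ (i, p) + x i * (S $$ (p, j) + x j * S $$ (p, p))"
      if "i < n" "j < n" for i j
      using shear_congruence_nth[OF S(1) pn pn that, of x "\<lambda>_. 0"] by (simp add: b_def)
    have Tp: "(b\<^sup>T * S * b) $$ (p, j) = (if j = p then S $$ (p, p) else 0)" if "j < n" for j
      using T[OF pn that] pp by (simp add: x_def)
    have Ti: "(b\<^sup>T * S * b) $$ (i, j) = S $$ (i, j)" if "i < n" "j < n" "i \<notin> I" for i j
      using T[OF that(1,2)] z[OF that(1,3)] pI that(3) by (auto simp: x_def)
    show ?thesis
      unfolding monomial_off_def
    proof (intro allI impI)
      fix i assume i: "i < n" "i \<notin> I - {p}"
      show "\<exists>q<n. q \<notin> I - {p} \<and> (b\<^sup>T * S * b) $$ (i, q) \<noteq> 0 \<and>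
              (\<forall>j<n. j \<noteq> q \<longrightarrow> (b\<^sup>T * S * b) $$ (i, j) = 0)"
      proof (cases "i = p")
        case True
        then show ?thesis using Tp pp pn by (intro exI[of _ p]) auto
      next
        case False
        with i have "i \<notin> I" by auto
        with mo i(1) obtain q where "q < n" "q \<notin> I" "S $$ (i, q) \<noteq> 0"
          "\<forall>j<n. j \<noteq> q \<longrightarrow> S $$ (i, j) = 0"
          by (auto simp: monomial_off_def)
        then show ?thesis using Ti[OF i(1) _ \<open>i \<notin> I\<close>] by (intro exI[of _ q]) auto
      qed
    qed
  qed
  ultimately show ?thesis by blast
qed

text \<open>With an off-diagonal pivot \<open>S\<^sub>p\<^sub>q\<close>, subtracting a multiple of column \<open>p\<close> from column \<open>q\<close>
  makes \<open>S\<^sub>q\<^sub>q\<close> vanish, at the price of a quadratic equation.\<close>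

lemma clear_corner:
  fixes S :: "'k::field fls mat"
  assumes two: "(2::'k) \<noteq> 0"
    and S: "S \<in> carrier_mat n n" "S\<^sup>T = S" and I: "I \<subseteq> {..<n}"
    and mo: "monomial_off n I S" and pv: "pivot I S p q" and pq: "p < q"
  shows "\<exists>b\<in>GL_Iwahori n. monomial_off n I (b\<^sup>T * S * b) \<and> pivot I (b\<^sup>T * S * b) p q \<and>
           (b\<^sup>T * S * b) $$ (q, q) = 0"
proof -
  define v where "v = fls_subdegree (S $$ (p, q))"
  have pI: "p \<in> I" and qI: "q \<in> I" and Spq: "S $$ (p, q) \<noteq> 0" and pn: "p < n" and qn: "q < n"
    and Sv: "\<And>i j. i \<in> I \<Longrightarrow> j \<in> I \<Longrightarrow> S $$ (i, j) \<in> frac_ideal v"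
    and Sv1: "\<And>i j. i \<in> I \<Longrightarrow> j \<in> I \<Longrightarrow> i < p \<Longrightarrow> S $$ (i, j) \<in> frac_ideal (v + 1)"
    and Sv2: "\<And>j. j \<in> I \<Longrightarrow> j < q \<Longrightarrow> S $$ (p, j) \<in> frac_ideal (v + 1)"
    using pv I by (auto simp: pivot_def v_def)
  have Sqp: "S $$ (q, p) = S $$ (p, q)" using symmetric_nth[OF S(2,1) qn pn] .
  obtain f where f: "f \<in> frac_ideal 0"
    and f0: "S $$ (q, q) - 2 * f * S $$ (p, q) + f ^ 2 * S $$ (p, p) = 0"
    using integral_quadratic_root[OF two Spq, of "S $$ (p, p)" "S $$ (q, q)"]
      Sv2[OF pI pq] Sv[OF qI qI] by (auto simp: v_def)
  define x where "x = (\<lambda>j. if j = q then - f else 0)"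
  define b where "b = shear n p p x (\<lambda>_. 0)"
  define T where "T = b\<^sup>T * S * b"
  have b: "b \<in> GL_Iwahori n"
    unfolding b_def using f pq by (intro shear_in_GL_Iwahori) (auto simp: x_def intro: frac_ideal_uminus)
  have T: "T $$ (i, j) = S $$ (i, j) + x j * S $$ (i, p) + x i * (S $$ (p, j) + x j * S $$ (p, p))"
    if "i < n" "j < n" for i j
    using shear_congruence_nth[OF S(1) pn pn that, of x "\<lambda>_. 0"] by (simp add: b_def T_def)
  have x0: "x j \<in> frac_ideal 0" for j using f by (auto simp: x_def intro: frac_ideal_uminus)
  have "T $$ (q, q) = S $$ (q, q) - 2 * f * S $$ (p, q) + f ^ 2 * S $$ (p, p)"
    using T[OF qn qn] Sqp by (simp add: x_def algebra_simps power2_eq_square)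
  then have Tqq: "T $$ (q, q) = 0" using f0 by simp
  have "monomial_off n I T"
    unfolding monomial_off_def
  proof (intro allI impI)
    fix i assume i: "i < n" "i \<notin> I"
    with mo obtain k where k: "k < n" "k \<notin> I" "S $$ (i, k) \<noteq> 0"
      "\<forall>j<n. j \<noteq> k \<longrightarrow> S $$ (i, j) = 0"
      by (auto simp: monomial_off_def)
    have "T $$ (i, j) = S $$ (i, j)" if "j < n" for j
      using T[OF i(1) that] i qI monomial_off_zero[OF mo S I pI i] by (auto simp: x_def)
    then show "\<exists>q<n. q \<notin> I \<and> T $$ (i, q) \<noteq> 0 \<and> (\<forall>j<n. j \<noteq> q \<longrightarrow> T $$ (i, j) = 0)"
      using k by (intro exI[of _ k]) auto
  qed
  moreover have "pivot I T p q"
  proof -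
    have Tpq: "T $$ (p, q) = S $$ (p, q) - f * S $$ (p, p)"
      using T[OF pn qn] pq by (simp add: x_def)
    have fS: "f * S $$ (p, p) \<in> frac_ideal (v + 1)"
      by (rule frac_ideal_mult_left[OF f Sv2[OF pI pq]])
    have "fls_nth (f * S $$ (p, p)) k = 0" if "k \<le> v" for k
      using fS that by (auto simp: frac_ideal_iff)
    then have "fls_nth (T $$ (p, q)) k = fls_nth (S $$ (p, q)) k" if "k \<le> v" for k
      using that by (simp add: Tpq)
    with Spq have nv: "fls_nth (T $$ (p, q)) v \<noteq> 0" and "\<And>k. k < v \<Longrightarrow> fls_nth (T $$ (p, q)) k = 0"
      by (simp_all add: v_def)
    then have sd: "T $$ (p, q) \<noteq> 0" "fls_subdegree (T $$ (p, q)) = v"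
      using fls_nonzeroI[OF nv] by (auto intro: fls_subdegree_eqI)
    have In: "i < n" if "i \<in> I" for i using that I by auto
    have "T $$ (i, j) \<in> frac_ideal v" if "i \<in> I" "j \<in> I" for i j
      unfolding T[OF In In, OF that]
      by (intro frac_ideal_add frac_ideal_mult_left x0 Sv that pI)
    moreover have "T $$ (i, j) \<in> frac_ideal (v + 1)" if "i \<in> I" "j \<in> I" "i < p" for i j
    proof -
      have "x i = 0" using that pq by (simp add: x_def)
      then show ?thesis
        unfolding T[OF In In, OF that(1,2)]
        by (simp, intro frac_ideal_add frac_ideal_mult_left x0 Sv1 that pI)
    qed
    moreover have "T $$ (p, j) \<in> frac_ideal (v + 1)" if "j \<in> I" "j < q" for j
      unfolding T[OF pn In, OF that(1)] using Sv2[OF that] pq that(2) by (simp add: x_def)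
    ultimately show ?thesis
      using sd pI qI by (simp add: pivot_def)
  qed
  ultimately show ?thesis using b Tqq unfolding T_def by blast
qed

text \<open>Once \<open>S\<^sub>q\<^sub>q = 0\<close>, a single shear splits off the hyperbolic plane spanned by \<open>e\<^sub>p\<close> and \<open>e\<^sub>q\<close>: multiples of
  column \<open>p\<close> clear row \<open>q\<close>, and multiples of column \<open>q\<close> clear row \<open>p\<close>.\<close>

lemma clear_off_diagonal_pivot:
  fixes S :: "'k::field fls mat"
  assumes two: "(2::'k) \<noteq> 0"
    and S: "S \<in> carrier_mat n n" "S\<^sup>T = S" and I: "I \<subseteq> {..<n}"
    and mo: "monomial_off n I S" and pv: "pivot I S p q" and pq: "p < q"
    and Sqq: "S $$ (q, q) = 0"
  shows "\<exists>b\<in>GL_Iwahori n. monomial_off n (I - {p, q}) (b\<^sup>T * S * b)"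
proof -
  define v where "v = fls_subdegree (S $$ (p, q))"
  have pI: "p \<in> I" and qI: "q \<in> I" and Spq: "S $$ (p, q) \<noteq> 0" and pn: "p < n" and qn: "q < n"
    and Sv: "\<And>i j. i \<in> I \<Longrightarrow> j \<in> I \<Longrightarrow> S $$ (i, j) \<in> frac_ideal v"
    and Sv1: "\<And>i j. i \<in> I \<Longrightarrow> j \<in> I \<Longrightarrow> i < p \<Longrightarrow> S $$ (i, j) \<in> frac_ideal (v + 1)"
    and Sv2: "\<And>j. j \<in> I \<Longrightarrow> j < q \<Longrightarrow> S $$ (p, j) \<in> frac_ideal (v + 1)"
    using pv I by (auto simp: pivot_def v_def)
  have two': "(2 :: 'k fls) \<noteq> 0" using two by (metis fls_const_eq_0_iff fls_const_numeral)
  have Sqp: "S $$ (q, p) = S $$ (p, q)" using symmetric_nth[OF S(2,1) qn pn] .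
  note zp = monomial_off_zero[OF mo S I pI] and zq = monomial_off_zero[OF mo S I qI]
  define x where "x = (\<lambda>j. if j = p \<or> j = q then 0 else - (S $$ (q, j) / S $$ (p, q)))"
  \<comment> \<open>The correction of \<open>S\<^sub>p\<^sub>p\<close> enters twice, by row and by column, whence the factor \<open>2\<close>.\<close>
  define y where "y = (\<lambda>j. if j = q then 0 else if j = p then - (S $$ (p, p) / (2 * S $$ (p, q)))
                        else - ((S $$ (p, j) + x j * S $$ (p, p)) / S $$ (p, q)))"
  define b where "b = shear n p q x y"
  define T where "T = b\<^sup>T * S * b"
  have x: "x j \<in> frac_ideal (if j < p then 1 else 0)" if "j < n" for j
  proof (cases "j \<in> I")
    case True
    have "S $$ (q, j) \<in> frac_ideal (v + 1)" if "j < p"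
      using Sv1[OF True qI that] symmetric_nth[OF S(2,1) qn \<open>j < n\<close>] by simp
    from frac_ideal_divide[OF this Spq] frac_ideal_divide[OF Sv[OF qI True] Spq] show ?thesis
      by (auto simp: x_def v_def[symmetric] intro!: frac_ideal_uminus)
  next
    case False
    then show ?thesis using zq[OF that] by (simp add: x_def)
  qed
  have x0: "x j \<in> frac_ideal 0" if "j < n" for j
    using x[OF that] by (cases "j < p") (auto intro: frac_ideal_mono)
  have y: "y j \<in> frac_ideal (if j < q then 1 else 0)" if "j < n" for j
  proof (cases "j \<in> I")
    case True
    have xS: "x j * S $$ (p, p) \<in> frac_ideal (v + 1)"
      by (rule frac_ideal_mult_left[OF x0[OF that] Sv2[OF pI pq]])
    have "S $$ (p, j) + x j * S $$ (p, p) \<in> frac_ideal (v + 1)" if "j < q"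
      using Sv2[OF True that] xS by (rule frac_ideal_add)
    moreover have "S $$ (p, j) + x j * S $$ (p, p) \<in> frac_ideal v"
      using Sv[OF pI True] frac_ideal_mono[OF xS, of v] by (intro frac_ideal_add) auto
    moreover have "S $$ (p, p) / (2 * S $$ (p, q)) \<in> frac_ideal 1"
      using frac_ideal_divide[OF Sv2[OF pI pq], of "2 * S $$ (p, q)"] Spq two'
      by (simp add: v_def)
    ultimately show ?thesis
      using frac_ideal_divide[of "S $$ (p, j) + x j * S $$ (p, p)" "v + 1", OF _ Spq]
        frac_ideal_divide[of "S $$ (p, j) + x j * S $$ (p, p)" v, OF _ Spq] pq
      by (auto simp: y_def v_def[symmetric] intro!: frac_ideal_uminus)
  next
    case False
    then show ?thesis using zq[OF that] zp[OF that] pI by (auto simp: y_def x_def)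
  qed
  have "b \<in> GL_Iwahori n"
    unfolding b_def using x y by (intro shear_in_GL_Iwahori) (auto simp: x_def y_def)
  moreover have "monomial_off n (I - {p, q}) T"
  proof -
    define u where "u = (\<lambda>i j. S $$ (i, j) + x j * S $$ (i, p) + y j * S $$ (i, q))"
    have T: "T $$ (i, j) = u i j + x i * u p j + y i * u q j" if "i < n" "j < n" for i j
      using shear_congruence_nth[OF S(1) pn qn that, of x y] by (simp add: b_def T_def u_def)
    have uq: "u q j = (if j = p then S $$ (p, q) else 0)" for j
      using Spq by (simp add: u_def x_def Sqq Sqp)
    have up: "u p j + y p * u q j = (if j = q then S $$ (p, q) else 0)" for j
      using Spq two' pq by (auto simp: uq) (auto simp: u_def x_def y_def Sqq field_simps)
    have Tq: "T $$ (q, j) = (if j = p then S $$ (p, q) else 0)" if "j < n" for j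
      using T[OF qn that] uq by (simp add: x_def y_def)
    have Tp: "T $$ (p, j) = (if j = q then S $$ (p, q) else 0)" if "j < n" for j
      using T[OF pn that] up[of j] by (simp add: x_def)
    have Ti: "T $$ (i, j) = S $$ (i, j)" if "i < n" "j < n" "i \<notin> I" for i j
      using T[OF that(1,2)] zp[OF that(1,3)] zq[OF that(1,3)] pI qI that(3)
      by (auto simp: x_def y_def u_def)
    show ?thesis
      unfolding monomial_off_def
    proof (intro allI impI)
      fix i assume i: "i < n" "i \<notin> I - {p, q}"
      consider "i = p" | "i = q" | "i \<notin> I" using i by auto
      then show "\<exists>k<n. k \<notin> I - {p, q} \<and> T $$ (i, k) \<noteq> 0 \<and> (\<forall>j<n. j \<noteq> k \<longrightarrow> T $$ (i, j) = 0)"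
      proof cases
        case 1
        then show ?thesis using Tp Spq qn by (intro exI[of _ q]) auto
      next
        case 2
        then show ?thesis using Tq Spq pn by (intro exI[of _ p]) auto
      next
        case 3
        with mo i(1) obtain k where "k < n" "k \<notin> I" "S $$ (i, k) \<noteq> 0"
          "\<forall>j<n. j \<noteq> k \<longrightarrow> S $$ (i, j) = 0"
          by (auto simp: monomial_off_def)
        then show ?thesis using Ti[OF i(1) _ 3] by (intro exI[of _ k]) auto
      qed
    qed
  qed
  ultimately show ?thesis unfolding T_def by blast
qed

lemma det_nonzero_row:
  fixes S :: "'a::comm_ring_1 mat"
  assumes "S \<in> carrier_mat n n" "det S \<noteq> 0" "p < n"
  shows "\<exists>j<n. S $$ (p, j) \<noteq> 0"
proof (rule ccontr)
  assume *: "\<not> ?thesis"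
  have "(\<Prod>i = 0..<n. S $$ (i, f i)) = 0" if "f permutes {0..<n}" for f
    using * assms(3) permutes_in_image[OF that, of p] by (intro prod_zero) auto
  then have "det S = 0" using assms(1) by (simp add: det_def' sum.neutral)
  with assms show False by simp
qed

lemma congruent_to_monomial_aux:
  fixes S :: "'k::field fls mat"
  assumes two: "(2::'k) \<noteq> 0"
    and "S \<in> carrier_mat n n" "S\<^sup>T = S" "det S \<noteq> 0" "I \<subseteq> {..<n}" "monomial_off n I S"
  shows "\<exists>b\<in>GL_Iwahori n. monomial_off n {} (b\<^sup>T * S * b)"
proof -
  have "finite I" using assms(5) by (rule finite_subset) simp
  then show ?thesis using assms(2-)
  proof (induction I arbitrary: S rule: finite_psubset_induct)
    case (psubset I)
    note S = psubset.prems(1,2) and I = psubset.prems(4) and mo = psubset.prems(5)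
    show ?case
    proof (cases "I = {}")
      case True
      show ?thesis using mo S True one_in_GL_Iwahori by (intro bexI[of _ "1\<^sub>m n"]) auto
    next
      case False
      then obtain i0 where i0: "i0 \<in> I" by blast
      with I have "i0 < n" by auto
      from det_nonzero_row[OF S(1) psubset.prems(3) this]
      obtain j0 where j0: "j0 < n" "S $$ (i0, j0) \<noteq> 0" by blast
      then have "j0 \<in> I" using monomial_off_zero(2)[OF mo S I i0] by blast
      from pivot_exists[OF psubset.hyps(1) i0 this j0(2)]
      obtain p q where pv: "pivot I S p q" by blast
      then have pqI: "p \<in> I" "q \<in> I" by (auto simp: pivot_def)
      have "\<exists>b\<in>GL_Iwahori n. \<exists>J. J \<subset> I \<and> monomial_off n J (b\<^sup>T * S * b)"
      proof (cases "p = q")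
        case True
        from clear_diagonal_pivot[OF S I mo, of p] pv True obtain b where
          "b \<in> GL_Iwahori n" "monomial_off n (I - {p}) (b\<^sup>T * S * b)" by blast
        then show ?thesis using pqI by (intro bexI[of _ b] exI[of _ "I - {p}"]) auto
      next
        case False
        with pivot_le[OF pv S I] have pq: "p < q" by simp
        from clear_corner[OF two S I mo pv pq] obtain b where b: "b \<in> GL_Iwahori n"
          and b': "monomial_off n I (b\<^sup>T * S * b)" "pivot I (b\<^sup>T * S * b) p q"
            "(b\<^sup>T * S * b) $$ (q, q) = 0" by blast
        have bc: "b \<in> carrier_mat n n" by (rule GL_IwahoriD(1)[OF b])
        have "b\<^sup>T * S * b \<in> carrier_mat n n" using bc S by auto
        from clear_off_diagonal_pivot[OF two this congruence_symmetric[OF bc S] I b'(1,2) pq b'(3)]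
        obtain c where c: "c \<in> GL_Iwahori n"
          and c': "monomial_off n (I - {p, q}) (c\<^sup>T * (b\<^sup>T * S * b) * c)" by blast
        then have "monomial_off n (I - {p, q}) ((b * c)\<^sup>T * S * (b * c))"
          using congruence_congruence[OF bc GL_IwahoriD(1)[OF c] S(1)] by simp
        with GL_Iwahori_mult[OF b c] show ?thesis
          using pqI by (intro bexI[of _ "b * c"] exI[of _ "I - {p, q}"]) auto
      qed
      then obtain b J where b: "b \<in> GL_Iwahori n" and J: "J \<subset> I" "monomial_off n J (b\<^sup>T * S * b)"
        by blast
      have bc: "b \<in> carrier_mat n n" by (rule GL_IwahoriD(1)[OF b])
      have T: "b\<^sup>T * S * b \<in> carrier_mat n n" using bc S by auto
      have "det (b\<^sup>T * S * b) \<noteq> 0"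
        using det_congruence[OF bc S(1)] GL_Iwahori_det_nonzero[OF b] psubset.prems(3) by simp
      from psubset.IH[OF J(1) T congruence_symmetric[OF bc S] this _ J(2)] J(1) I
      obtain c where c: "c \<in> GL_Iwahori n" "monomial_off n {} (c\<^sup>T * (b\<^sup>T * S * b) * c)" by blast
      then have "monomial_off n {} ((b * c)\<^sup>T * S * (b * c))"
        using congruence_congruence[OF bc GL_IwahoriD(1)[OF c(1)] S(1)] by simp
      with GL_Iwahori_mult[OF b c(1)] show ?thesis by blast
    qed
  qed
qed

lemma symmetric_monomial_matI:
  assumes T: "T \<in> carrier_mat n n" "T\<^sup>T = T" and mo: "monomial_off n {} T"
  shows "monomial_mat n T"
proof -
  have "\<exists>!q. q < n \<and> T $$ (p, q) \<noteq> 0" if "p < n" for p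
    using mo that unfolding monomial_off_def by (metis empty_iff)
  moreover from this have "\<exists>!p. p < n \<and> T $$ (p, q) \<noteq> 0" if "q < n" for q
    using symmetric_nth[OF T(2,1) _ that] that by (metis (no_types, lifting))
  ultimately show ?thesis using T(1) by (simp add: monomial_mat_def)
qed

theorem congruent_to_monomial:
  fixes S :: "'k::field fls mat"
  assumes two: "(2::'k) \<noteq> 0" and S: "S \<in> carrier_mat n n" "S\<^sup>T = S" "det S \<noteq> 0"
  obtains b where "b \<in> GL_Iwahori n" "monomial_mat n (b\<^sup>T * S * b)"
proof -
  have "monomial_off n {..<n} S" by (auto simp: monomial_off_def)
  from congruent_to_monomial_aux[OF two S subset_refl this]
  obtain b where b: "b \<in> GL_Iwahori n" "monomial_off n {} (b\<^sup>T * S * b)" by blast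
  have bc: "b \<in> carrier_mat n n" by (rule GL_IwahoriD(1)[OF b(1)])
  have "monomial_mat n (b\<^sup>T * S * b)"
    by (rule symmetric_monomial_matI[OF _ congruence_symmetric[OF bc S(1,2)] b(2)])
      (use bc S in auto)
  with b(1) show ?thesis by (rule that)
qed

section \<open>Matrices supported on blocks of size one and two\<close>

text \<open>A partition of \<open>{0, \<dots>, n - 1}\<close> into the singletons of \<open>E\<close> and the two-element sets \<open>{j, k}\<close>
  for \<open>(j, k) \<in> P\<close>, where \<open>j < k\<close>.\<close>

definition pair_partition :: "nat \<Rightarrow> nat set \<Rightarrow> (nat \<times> nat) set \<Rightarrow> bool" where
  "pair_partition n E P \<longleftrightarrow> E \<subseteq> {..<n} \<and>
     (\<forall>j k. (j, k) \<in> P \<longrightarrow> j < k \<and> k < n \<and> j \<notin> E \<and> k \<notin> E) \<and>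
     (\<forall>p<n. p \<notin> E \<longrightarrow> (\<exists>!jk. jk \<in> P \<and> (p = fst jk \<or> p = snd jk)))"

text \<open>Two indices lie in the same part of the partition.\<close>

definition same_block :: "(nat \<times> nat) set \<Rightarrow> nat \<Rightarrow> nat \<Rightarrow> bool" where
  "same_block P p q \<longleftrightarrow> p = q \<or> (p, q) \<in> P \<or> (q, p) \<in> P"

lemma same_block_sym: "same_block P p q = same_block P q p"
  by (auto simp: same_block_def)

lemma pair_partitionD:
  assumes "pair_partition n E P"
  shows "p \<in> E \<Longrightarrow> p < n"
    and "(j, k) \<in> P \<Longrightarrow> j < k \<and> k < n \<and> j < n \<and> j \<notin> E \<and> k \<notin> E"
    and "finite E" "finite P"
proof -
  show "p \<in> E \<Longrightarrow> p < n"
    using assms by (auto simp: pair_partition_def)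
  show *: "j < k \<and> k < n \<and> j < n \<and> j \<notin> E \<and> k \<notin> E" if "(j, k) \<in> P" for j k
  proof -
    have "j < k \<and> k < n \<and> j \<notin> E \<and> k \<notin> E"
      using assms that by (simp add: pair_partition_def)
    then show ?thesis by auto
  qed
  show "finite E" using assms finite_subset by (auto simp: pair_partition_def)
  show "finite P" by (rule finite_subset[of _ "{..<n} \<times> {..<n}"]) (use * in auto)
qed

lemma pair_partition_unique:
  assumes "pair_partition n E P" "(j, k) \<in> P" "(j', k') \<in> P" "j = j' \<or> j = k' \<or> k = j' \<or> k = k'"
  shows "j' = j \<and> k' = k"
proof -
  obtain p where p: "p = j \<or> p = k" "p = j' \<or> p = k'" using assms(4) by auto
  then have "p < n" "p \<notin> E" using pair_partitionD(2)[OF assms(1,2)] by auto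
  then have "\<exists>!jk. jk \<in> P \<and> (p = fst jk \<or> p = snd jk)"
    using assms(1) unfolding pair_partition_def by blast
  then have "(j, k) = (j', k')" using assms(2,3) p by (elim ex1E) (metis fst_conv snd_conv)
  then show ?thesis by simp
qed

lemma pair_partition_cases [consumes 2, case_names single fst snd]:
  assumes "pair_partition n E P" "p < n"
  obtains "p \<in> E" | k where "(p, k) \<in> P" | j where "(j, p) \<in> P"
proof (cases "p \<in> E")
  case False
  with assms have "\<exists>!jk. jk \<in> P \<and> (p = fst jk \<or> p = snd jk)"
    by (simp add: pair_partition_def)
  then obtain jk where "jk \<in> P" "p = fst jk \<or> p = snd jk" by blast
  then show ?thesis using that(2)[of "snd jk"] that(3)[of "fst jk"] by auto
qed (rule that(1))

text \<open>Stated for an arbitrary commutative operation, because it is used for sums of exponents as well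
  as for products of diagonal entries.\<close>

lemma (in comm_monoid_set) pair_partition:
  assumes pp: "pair_partition n E P"
  shows "F g {..<n} = F g E \<^bold>* F (\<lambda>(j, k). g j \<^bold>* g k) P"
proof -
  note D = pair_partitionD[OF pp] and u = pair_partition_unique[OF pp]
  have eq: "a = b" if "a \<in> P" "b \<in> P" "fst a = fst b \<or> fst a = snd b \<or> snd a = snd b" for a b
    using u[of "fst a" "snd a" "fst b" "snd b"] that by (auto simp: prod_eq_iff)
  have inj: "inj_on fst P" "inj_on snd P" by (intro inj_onI eq; simp)+
  have "{..<n} = E \<union> (fst ` P \<union> snd ` P)"
  proof (intro equalityI subsetI)
    fix p assume "p \<in> {..<n}"
    then have "p < n" by simp
    with pp show "p \<in> E \<union> (fst ` P \<union> snd ` P)"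
      by (cases rule: pair_partition_cases) (auto intro: rev_image_eqI)
  next
    fix p assume "p \<in> E \<union> (fst ` P \<union> snd ` P)"
    then show "p \<in> {..<n}" using D(1,2) by auto
  qed
  also have "F g \<dots> = F g E \<^bold>* (F g (fst ` P) \<^bold>* F g (snd ` P))"
  proof -
    have "E \<inter> (fst ` P \<union> snd ` P) = {}" using D(2) by force
    moreover have "fst a \<noteq> snd b" if "a \<in> P" "b \<in> P" for a b
      using eq[OF that] D(2)[of "fst a" "snd a"] that by auto
    then have "fst ` P \<inter> snd ` P = {}" by blast
    ultimately show ?thesis using D(3,4) by (simp add: union_disjoint)
  qed
  also have "F g (fst ` P) \<^bold>* F g (snd ` P) = F (\<lambda>(j, k). g j \<^bold>* g k) P"
    using inj by (simp add: reindex distrib[symmetric] split_def)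
  finally show ?thesis .
qed

lemma same_block_single: "pair_partition n E P \<Longrightarrow> p \<in> E \<Longrightarrow> same_block P p q \<longleftrightarrow> q = p"
  using pair_partitionD(2)[of n E P p q] pair_partitionD(2)[of n E P q p] by (auto simp: same_block_def)

lemma same_block_pair:
  assumes "pair_partition n E P" "(j, k) \<in> P"
  shows "same_block P j q \<longleftrightarrow> q = j \<or> q = k" and "same_block P k q \<longleftrightarrow> q = j \<or> q = k"
proof -
  note D = pair_partitionD(2)[OF assms] and u = pair_partition_unique[OF assms]
  show "same_block P j q \<longleftrightarrow> q = j \<or> q = k"
    using u[of j q] u[of q j] assms(2) D by (auto simp: same_block_def)
  show "same_block P k q \<longleftrightarrow> q = j \<or> q = k"
    using u[of k q] u[of q k] assms(2) D by (auto simp: same_block_def)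
qed

lemma sum_single_block:
  fixes g h :: "nat \<Rightarrow> 'a::semiring_0"
  assumes pp: "pair_partition n E P" and p: "p \<in> E"
    and g: "\<And>l. l < n \<Longrightarrow> \<not> same_block P p l \<Longrightarrow> g l = 0"
  shows "(\<Sum>l<n. g l * h l) = g p * h p"
proof -
  have "(\<Sum>l<n. g l * h l) = (\<Sum>l\<in>{p}. g l * h l)"
    using g same_block_single[OF pp p] pair_partitionD(1)[OF pp p]
    by (intro sum.mono_neutral_right) auto
  then show ?thesis by simp
qed

lemma sum_pair_block:
  fixes g h :: "nat \<Rightarrow> 'a::semiring_0"
  assumes pp: "pair_partition n E P" and jk: "(j, k) \<in> P" "p = j \<or> p = k"
    and g: "\<And>l. l < n \<Longrightarrow> \<not> same_block P p l \<Longrightarrow> g l = 0"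
  shows "(\<Sum>l<n. g l * h l) = g j * h j + g k * h k"
proof -
  have "g l = 0" if "l < n" "l \<noteq> j" "l \<noteq> k" for l
    using g[OF that(1)] same_block_pair[OF pp jk(1)] jk(2) that by auto
  then have "(\<Sum>l<n. g l * h l) = (\<Sum>l\<in>{j, k}. g l * h l)"
    using pair_partitionD(2)[OF pp jk(1)] by (intro sum.mono_neutral_right) auto
  then show ?thesis using pair_partitionD(2)[OF pp jk(1)] by simp
qed

text \<open>The Gram matrix of a matrix supported on the blocks can be verified block by block.\<close>

lemma gram_block_matrix:
  fixes G w :: "'a::comm_ring_1 mat"
  assumes pp: "pair_partition n E P"
    and G: "G \<in> carrier_mat n n" and w: "w \<in> carrier_mat n n"
    and sG: "\<And>p q. p < n \<Longrightarrow> q < n \<Longrightarrow> \<not> same_block P p q \<Longrightarrow> G $$ (p, q) = 0"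
    and sw: "\<And>p q. p < n \<Longrightarrow> q < n \<Longrightarrow> \<not> same_block P p q \<Longrightarrow> w $$ (p, q) = 0"
    and single: "\<And>p. p \<in> E \<Longrightarrow> G $$ (p, p) * G $$ (p, p) = w $$ (p, p)"
    and pair: "\<And>j k p q. (j, k) \<in> P \<Longrightarrow> p = j \<or> p = k \<Longrightarrow> q = j \<or> q = k \<Longrightarrow>
      G $$ (j, p) * G $$ (j, q) + G $$ (k, p) * G $$ (k, q) = w $$ (p, q)"
  shows "G\<^sup>T * G = w"
proof (rule eq_matI)
  fix p q assume "p < dim_row w" "q < dim_col w"
  then have p: "p < n" and q: "q < n" using w by auto
  have s: "G $$ (l, p) = 0" if "l < n" "\<not> same_block P p l" for l
    using sG[of l p] that p by (simp add: same_block_sym)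
  have pairs: "(\<Sum>l<n. G $$ (l, p) * G $$ (l, q)) = w $$ (p, q)" if jk: "(j, k) \<in> P" "p = j \<or> p = k" for j k
  proof (cases "q = j \<or> q = k")
    case True
    then show ?thesis
      using sum_pair_block[OF pp jk, where g = "\<lambda>l. G $$ (l, p)" and h = "\<lambda>l. G $$ (l, q)", OF s] pair[OF jk] by simp
  next
    case False
    then have "\<not> same_block P j q" "\<not> same_block P k q" "\<not> same_block P p q"
      using same_block_pair[OF pp jk(1)] jk(2) by auto
    then show ?thesis
      using sum_pair_block[OF pp jk, where g = "\<lambda>l. G $$ (l, p)" and h = "\<lambda>l. G $$ (l, q)", OF s] sG[of _ q] sw[OF p q] q
        pair_partitionD(2)[OF pp jk(1)] by simp
  qed
  have "(G\<^sup>T * G) $$ (p, q) = (\<Sum>l<n. G $$ (l, p) * G $$ (l, q))"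
    using mult_mat_nth[of "G\<^sup>T" n G p q] G p q by simp
  also have "\<dots> = w $$ (p, q)"
    using pp p
  proof (cases rule: pair_partition_cases)
    case 1: single
    have "(\<Sum>l<n. G $$ (l, p) * G $$ (l, q)) = G $$ (p, p) * G $$ (p, q)"
      by (rule sum_single_block[OF pp 1, where g = "\<lambda>l. G $$ (l, p)", OF s])
    also have "\<dots> = w $$ (p, q)"
      using single[OF 1] sG[OF p q] sw[OF p q] same_block_single[OF pp 1]
      by (cases "q = p") auto
    finally show ?thesis .
  qed (use pairs in auto)
  finally show "(G\<^sup>T * G) $$ (p, q) = w $$ (p, q)" .
qed (use G w in auto)

text \<open>Subtracting a multiple of row \<open>j\<close> from row \<open>k\<close> for each \<open>(j, k) \<in> P\<close> makes the matrix upper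
  triangular.\<close>

lemma det_block_matrix:
  fixes G :: "'a::field mat"
  assumes pp: "pair_partition n E P" and G: "G \<in> carrier_mat n n"
    and sG: "\<And>p q. p < n \<Longrightarrow> q < n \<Longrightarrow> \<not> same_block P p q \<Longrightarrow> G $$ (p, q) = 0"
    and nz: "\<And>j k. (j, k) \<in> P \<Longrightarrow> G $$ (j, j) \<noteq> 0"
  shows "det G = (\<Prod>j\<in>E. G $$ (j, j)) *
    (\<Prod>(j, k)\<in>P. G $$ (j, j) * G $$ (k, k) - G $$ (j, k) * G $$ (k, j))"
proof -
  note D = pair_partitionD(2)[OF pp]
  define L where "L = mat n n (\<lambda>(p, q). if p = q then 1
    else if (q, p) \<in> P then - (G $$ (p, q) / G $$ (q, q)) else 0)"
  define R where "R = L * G"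
  have L: "L \<in> carrier_mat n n" and R: "R \<in> carrier_mat n n" using G by (auto simp: L_def R_def)
  have "det L = 1"
  proof -
    have "det L = prod_list (diag_mat L)"
      by (rule det_lower_triangular[OF _ L]) (auto simp: L_def dest: D)
    also have "\<dots> = 1"
      by (simp add: diag_mat_def prod.list_conv_set_nth) (auto simp: L_def)
    finally show ?thesis .
  qed
  then have det: "det G = det R"
    unfolding R_def using det_mult[OF L G] by simp
  have R_nth: "R $$ (p, q) = (\<Sum>l<n. L $$ (p, l) * G $$ (l, q))" if "p < n" "q < n" for p q
    unfolding R_def by (rule mult_mat_nth[OF L G that])
  have sL: "L $$ (p, l) = 0" if "p < n" "l < n" "\<not> same_block P p l" for p l
    using that by (auto simp: L_def same_block_def)
  have RE: "R $$ (p, q) = G $$ (p, q)" if "p \<in> E" "q < n" for p q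
  proof -
    have p: "p < n" by (rule pair_partitionD(1)[OF pp that(1)])
    show ?thesis
      using sum_single_block[OF pp that(1), where g = "\<lambda>l. L $$ (p, l)" and h = "\<lambda>l. G $$ (l, q)",
          OF sL[OF p]] R_nth[OF p that(2)] p
      by (simp add: L_def)
  qed
  have Rj: "R $$ (j, q) = G $$ (j, q)" if "(j, k) \<in> P" "q < n" for j k q
  proof -
    have jk: "j < n" "k < n" "j < k" using D[OF that(1)] by auto
    have "(k, j) \<notin> P" using D jk by fastforce
    then show ?thesis
      using sum_pair_block[OF pp that(1), where p = j and g = "\<lambda>l. L $$ (j, l)" and h = "\<lambda>l. G $$ (l, q)",
          OF _ sL[OF jk(1)]] R_nth[OF jk(1) that(2)] jk
      by (simp add: L_def)
  qed
  have Rk: "R $$ (k, q) = G $$ (k, q) - G $$ (k, j) / G $$ (j, j) * G $$ (j, q)"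
    if "(j, k) \<in> P" "q < n" for j k q
  proof -
    have jk: "j < n" "k < n" "j < k" using D[OF that(1)] by auto
    then show ?thesis
      using sum_pair_block[OF pp that(1), where p = k and g = "\<lambda>l. L $$ (k, l)" and h = "\<lambda>l. G $$ (l, q)",
          OF _ sL[OF jk(2)]] R_nth[OF jk(2) that(2)] that(1)
      by (simp add: L_def)
  qed
  have ut: "upper_triangular R"
  proof (rule upper_triangularI)
    fix p q assume qp: "q < p" and "p < dim_row R"
    then have p: "p < n" and q: "q < n" using R by auto
    from pp p show "R $$ (p, q) = 0"
    proof (cases rule: pair_partition_cases)
      case 1: single
      then show ?thesis using RE[OF 1 q] sG[OF p q] same_block_single[OF pp 1] qp by auto
    next
      case 2: (fst k)
      then show ?thesis using Rj[OF 2 q] sG[OF p q] same_block_pair[OF pp 2] qp D[OF 2] by auto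
    next
      case 3: (snd j)
      show ?thesis
      proof (cases "q = j")
        case True
        then show ?thesis using Rk[OF 3 q] nz[OF 3] by simp
      next
        case False
        then show ?thesis
          using Rk[OF 3 q] sG[OF p q] sG[of j q] same_block_pair[OF pp 3] qp D[OF 3] q by auto
      qed
    qed
  qed
  have "det R = (\<Prod>p<n. R $$ (p, p))"
    using det_upper_triangular[OF ut R] R
    by (simp add: diag_mat_def prod.list_conv_set_nth atLeast0LessThan)
  also have "\<dots> = (\<Prod>p\<in>E. R $$ (p, p)) * (\<Prod>(j, k)\<in>P. R $$ (j, j) * R $$ (k, k))"
    by (rule prod.pair_partition[OF pp])
  also have "(\<Prod>p\<in>E. R $$ (p, p)) = (\<Prod>p\<in>E. G $$ (p, p))"
    using RE pair_partitionD(1)[OF pp] by (intro prod.cong) auto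
  also have "(\<Prod>(j, k)\<in>P. R $$ (j, j) * R $$ (k, k)) =
      (\<Prod>(j, k)\<in>P. G $$ (j, j) * G $$ (k, k) - G $$ (j, k) * G $$ (k, j))"
  proof (intro prod.cong refl, safe)
    fix j k assume jk: "(j, k) \<in> P"
    then show "R $$ (j, j) * R $$ (k, k) = G $$ (j, j) * G $$ (k, k) - G $$ (j, k) * G $$ (k, j)"
      using Rj[OF jk, of j] Rk[OF jk, of k] nz[OF jk] D[OF jk] by (simp add: field_simps)
  qed
  finally show ?thesis using det by simp
qed

lemma block_sum_nth:
  fixes x :: "nat \<Rightarrow> 'a::comm_monoid_add" and f :: "nat \<times> nat \<Rightarrow> nat \<times> nat \<Rightarrow> 'a"
  assumes pp: "pair_partition n E P"
    and f: "\<And>j k p q. f (j, k) (p, q) \<noteq> 0 \<Longrightarrow> (p = j \<or> p = k) \<and> (q = j \<or> q = k)"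
  defines "M \<equiv> \<lambda>pq. (\<Sum>j\<in>E. if pq = (j, j) then x j else 0) + (\<Sum>jk\<in>P. f jk pq)"
  shows "p \<in> E \<Longrightarrow> M (p, p) = x p"
    and "(j, k) \<in> P \<Longrightarrow> p = j \<or> p = k \<Longrightarrow> q = j \<or> q = k \<Longrightarrow> M (p, q) = f (j, k) (p, q)"
    and "\<not> same_block P p q \<Longrightarrow> M (p, q) = 0"
proof -
  note D = pair_partitionD[OF pp] and u = pair_partition_unique[OF pp]
  show "M (p, p) = x p" if "p \<in> E"
  proof -
    have "(\<Sum>jk\<in>P. f jk (p, p)) = 0"
      using f D(2) that by (intro sum.neutral) force
    then show ?thesis using that D(3) by (simp add: M_def)
  qed
  show "M (p, q) = f (j, k) (p, q)" if jk: "(j, k) \<in> P" and p: "p = j \<or> p = k" and q: "q = j \<or> q = k"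
  proof -
    have "f jk' (p, q) = 0" if "jk' \<in> P - {(j, k)}" for jk'
    proof -
      obtain j' k' where jk': "jk' = (j', k')" by (cases jk')
      with that u[OF jk, of j' k'] have "\<not> (p = j' \<or> p = k')" using p by auto
      then show ?thesis using f[of j' k' p q] jk' by blast
    qed
    then have "(\<Sum>jk\<in>P. f jk (p, q)) = (\<Sum>jk\<in>{(j, k)}. f jk (p, q))"
      using jk D(4) by (intro sum.mono_neutral_right) auto
    moreover have "(\<Sum>i\<in>E. if (p, q) = (i, i) then x i else 0) = 0"
      using D(2)[OF jk] p by (intro sum.neutral) auto
    ultimately show ?thesis by (simp add: M_def)
  qed
  show "M (p, q) = 0" if "\<not> same_block P p q"
  proof -
    have "f jk (p, q) = 0" if "jk \<in> P" for jk
      using f[of "fst jk" "snd jk" p q] that \<open>\<not> same_block P p q\<close>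
      by (cases jk) (auto simp: same_block_def)
    moreover have "p \<noteq> q" using that by (auto simp: same_block_def)
    ultimately show ?thesis by (auto simp: M_def intro!: sum.neutral)
  qed
qed

text \<open>Pairing the first entry of a list with the second, the third with the fourth, and so on.\<close>

lemma consecutive_pairs:
  fixes xs :: "nat list"
  assumes xs: "sorted_wrt (<) xs" and even: "even (length xs)"
  defines "Q \<equiv> {(xs ! (2 * m), xs ! (2 * m + 1)) | m. 2 * m + 1 < length xs}"
  shows "(j, k) \<in> Q \<Longrightarrow> j < k \<and> j \<in> set xs \<and> k \<in> set xs"
    and "x \<in> set xs \<Longrightarrow> \<exists>!jk. jk \<in> Q \<and> (x = fst jk \<or> x = snd jk)"
proof -
  show "j < k \<and> j \<in> set xs \<and> k \<in> set xs" if "(j, k) \<in> Q"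
    using that sorted_wrt_nth_less[OF xs] by (auto simp: Q_def)
  assume "x \<in> set xs"
  then obtain i where i: "i < length xs" "x = xs ! i" by (auto simp: in_set_conv_nth)
  have dist: "distinct xs" using xs by (simp add: strict_sorted_iff)
  define m where "m = i div 2"
  have im: "i = 2 * m \<or> i = 2 * m + 1" by (auto simp: m_def)
  have m: "2 * m + 1 < length xs" using im i(1) even by (elim disjE) presburger+
  show "\<exists>!jk. jk \<in> Q \<and> (x = fst jk \<or> x = snd jk)"
  proof (rule ex1I[of _ "(xs ! (2 * m), xs ! (2 * m + 1))"])
    show "(xs ! (2 * m), xs ! (2 * m + 1)) \<in> Q \<and>
        (x = fst (xs ! (2 * m), xs ! (2 * m + 1)) \<or> x = snd (xs ! (2 * m), xs ! (2 * m + 1)))"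
      using m im i(2) by (auto simp: Q_def)
    fix jk assume "jk \<in> Q \<and> (x = fst jk \<or> x = snd jk)"
    then obtain m' where m': "2 * m' + 1 < length xs" "jk = (xs ! (2 * m'), xs ! (2 * m' + 1))"
      and "x = xs ! (2 * m') \<or> x = xs ! (2 * m' + 1)"
      by (auto simp: Q_def)
    then have "i = 2 * m' \<or> i = 2 * m' + 1"
      using i nth_eq_iff_index_eq[OF dist] by auto
    then have "m' = m" by (auto simp: m_def)
    then show "jk = (xs ! (2 * m), xs ! (2 * m + 1))" using m'(2) by simp
  qed
qed

section \<open>Symmetric monomial matrices\<close>

lemma monomial_mat_perm:
  assumes "monomial_mat n w" "q < n"
  shows "perm_of n w q < n" and "w $$ (perm_of n w q, q) \<noteq> 0"
    and "p < n \<Longrightarrow> w $$ (p, q) \<noteq> 0 \<longleftrightarrow> p = perm_of n w q"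
proof -
  have ex1: "\<exists>!p. p < n \<and> w $$ (p, q) \<noteq> 0" using assms by (auto simp: monomial_mat_def)
  then have *: "perm_of n w q < n \<and> w $$ (perm_of n w q, q) \<noteq> 0"
    unfolding perm_of_def by (rule theI')
  then show "perm_of n w q < n" and "w $$ (perm_of n w q, q) \<noteq> 0" by auto
  show "p < n \<Longrightarrow> w $$ (p, q) \<noteq> 0 \<longleftrightarrow> p = perm_of n w q" using ex1 * by blast
qed

lemma symmetric_monomial_perm:
  assumes w: "monomial_mat n w" "w\<^sup>T = w" and q: "q < n"
  shows "perm_of n w (perm_of n w q) = q" and "expo n w (perm_of n w q) = expo n w q"
    and "w $$ (q, perm_of n w q) = w $$ (perm_of n w q, q)"
proof -
  have c: "w \<in> carrier_mat n n" using w by (simp add: monomial_mat_def)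
  note m = monomial_mat_perm[OF w(1)]
  show e: "w $$ (q, perm_of n w q) = w $$ (perm_of n w q, q)"
    by (rule symmetric_nth[OF w(2) c q m(1)[OF q]])
  then show i: "perm_of n w (perm_of n w q) = q"
    using m(2)[OF q] m(3)[OF m(1)[OF q] q] by simp
  show "expo n w (perm_of n w q) = expo n w q"
    unfolding expo_def i e ..
qed

lemma perm_partition:
  assumes w: "monomial_mat n w" "w\<^sup>T = w"
  shows "pair_partition n {j. j < n \<and> perm_of n w j = j} (two_cycles n w)"
proof -
  let ?s = "perm_of n w"
  have "\<exists>!jk. jk \<in> two_cycles n w \<and> (p = fst jk \<or> p = snd jk)" if p: "p < n" "?s p \<noteq> p" for p
  proof (rule ex1I[of _ "if p < ?s p then (p, ?s p) else (?s p, p)"])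
    show "jk = (if p < ?s p then (p, ?s p) else (?s p, p))"
      if "jk \<in> two_cycles n w \<and> (p = fst jk \<or> p = snd jk)" for jk
      using that by (auto simp: two_cycles_def)
  qed (use p monomial_mat_perm(1)[OF w(1) p(1)] symmetric_monomial_perm(1)[OF w p(1)] in
    \<open>auto simp: two_cycles_def\<close>)
  then show ?thesis by (auto simp: pair_partition_def two_cycles_def)
qed

text \<open>Only one permutation contributes to the determinant of a monomial matrix, so the order of the
  determinant is the sum of the exponents.\<close>

lemma det_symmetric_monomial:
  assumes w: "monomial_mat n w" "w\<^sup>T = w" and det: "fls_subdegree (det w) = 0"
  shows "(\<Sum>j<n. expo n w j) = 0"
proof -
  let ?s = "\<lambda>j. if j < n then perm_of n w j else j"
  have c: "w \<in> carrier_mat n n" using w by (simp add: monomial_mat_def)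
  note m = monomial_mat_perm[OF w(1)] and i = symmetric_monomial_perm[OF w]
  have s: "?s permutes {0..<n}"
  proof (rule bij_imp_permutes)
    show "bij_betw ?s {0..<n} {0..<n}"
      by (rule bij_betw_byWitness[of _ ?s]) (use m(1) i(1) in auto)
  qed simp
  have z: "(\<Prod>j = 0..<n. w $$ (j, f j)) = 0" if f: "f permutes {0..<n}" "f \<noteq> ?s" for f
  proof -
    obtain j where j: "f j \<noteq> ?s j" using f(2) by auto
    then have jn: "j < n" using permutes_not_in[OF f(1), of j] by (cases "j < n") auto
    then have fn: "f j < n" using permutes_in_image[OF f(1), of j] by auto
    have "j \<noteq> perm_of n w (f j)" using i(1)[OF fn] j jn fn by auto
    then have "w $$ (j, f j) = 0" using m(3)[OF fn jn] by simp
    then show ?thesis using jn by (intro prod_zero) auto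
  qed
  have "det w = (\<Sum>f\<in>{?s}. signof f * (\<Prod>j = 0..<n. w $$ (j, f j)))"
    unfolding det_def'[OF c] using s z by (intro sum.mono_neutral_right) (auto simp: finite_permutations)
  also have "\<dots> = signof ?s * (\<Prod>j<n. w $$ (j, perm_of n w j))"
    by (simp add: atLeast0LessThan)
  finally have dw: "det w = signof ?s * (\<Prod>j<n. w $$ (j, perm_of n w j))" .
  have sd: "(\<Prod>j\<in>J. w $$ (j, perm_of n w j)) \<noteq> 0 \<and>
      fls_subdegree (\<Prod>j\<in>J. w $$ (j, perm_of n w j)) = (\<Sum>j\<in>J. expo n w j)"
    if "J \<subseteq> {..<n}" for J
    using finite_subset[OF that finite_lessThan] that
  proof (induction J rule: finite_induct)
    case (insert j J)
    then have "j < n" by auto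
    with insert m(2)[of j] i(3)[of j] show ?case by (simp add: expo_def)
  qed simp
  have "fls_subdegree (det w) = (\<Sum>j<n. expo n w j)"
    using sd[OF subset_refl] by (simp add: dw sign_def)
  with det show ?thesis by simp
qed

lemma tmono_eq_0_iff [simp]: "tmono x a = 0 \<longleftrightarrow> x = 0"
  by (simp add: tmono_def)

lemma tmono_subdegree: "x \<noteq> 0 \<Longrightarrow> fls_subdegree (tmono x a) = a"
  by (simp add: tmono_def fls_const_nonzero)

lemma tmono_mult: "tmono x a * tmono y b = tmono (x * y) (a + b)"
proof -
  have "tmono x a * tmono y b = (fls_const x * fls_const y) * (fls_X_intpow a * fls_X_intpow b)"
    unfolding tmono_def by (simp only: mult_ac)
  also have "\<dots> = tmono (x * y) (a + b)"
    unfolding tmono_def by (simp add: fls_X_intpow_times_fls_X_intpow add.commute del: fls_shift_fls_shift)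
  finally show ?thesis .
qed

lemma tmono_add: "tmono x a + tmono y a = tmono (x + y) a"
  by (simp add: tmono_def ring_distribs(2)[symmetric] fls_plus_const)

lemma tmono_uminus: "- tmono x a = tmono (- x) a"
  by (simp add: tmono_def)

lemma tmono_diff: "tmono x a - tmono y a = tmono (x - y) a"
  using tmono_add[of x a "- y"] by (simp add: tmono_uminus[symmetric])

lemma tmono_0 [simp]: "tmono 0 a = 0"
  by simp

lemma fls_const_eq_tmono: "fls_const x = tmono x 0"
  by (simp add: tmono_def)

lemma X_intpow_eq_tmono: "fls_X_intpow a = tmono 1 a"
  by (simp add: tmono_def)

lemma tmono_halve:
  fixes x :: "'k::field"
  assumes "(2::'k) \<noteq> 0"
  shows "tmono x a / 2 = tmono (x / 2) a"
proof -
  have "2 * tmono (x / 2) a = tmono 2 0 * tmono (x / 2) a"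
    by (simp add: fls_const_eq_tmono[symmetric])
  also have "\<dots> = tmono x a"
    using assms by (simp add: tmono_mult)
  moreover have "(2 :: 'k fls) \<noteq> 0" using assms by (metis fls_const_eq_0_iff fls_const_numeral)
  ultimately show ?thesis by (metis nonzero_mult_div_cancel_left)
qed

lemma tmono_eq_iff: "x \<noteq> 0 \<Longrightarrow> tmono x a = tmono y b \<longleftrightarrow> x = y \<and> a = b"
proof
  assume x: "x \<noteq> 0" and e: "tmono x a = tmono y b"
  from e have "fls_nth (tmono x a) a = fls_nth (tmono y b) a" by simp
  then show "x = y \<and> a = b" using x by (simp add: tmono_def split: if_splits)
qed simp

text \<open>The conditions defining the index set, without the one on the determinant, which is established
  last for a matrix obtained by reduction.\<close>

definition apm_shape :: "'k::field \<Rightarrow> nat \<Rightarrow> 'k fls mat \<Rightarrow> bool" where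
  "apm_shape im n w \<longleftrightarrow> monomial_mat n w \<and> w\<^sup>T = w \<and>
     (if \<exists>p<n. w $$ (p, p) \<noteq> 0
      then (\<forall>p<n. w $$ (p, p) \<noteq> 0 \<longrightarrow> (\<exists>a. w $$ (p, p) = tmono 1 a)) \<and>
           (\<forall>p<n. \<forall>q<n. p \<noteq> q \<and> w $$ (p, q) \<noteq> 0 \<longrightarrow> (\<exists>a. w $$ (p, q) = tmono im a))
      else (\<forall>p<n. \<forall>q<n. w $$ (p, q) \<noteq> 0 \<longrightarrow>
             (if p = 0 \<or> q = 0
              then \<exists>a. w $$ (p, q) = tmono im a \<or> w $$ (p, q) = tmono (- im) a
              else \<exists>a. w $$ (p, q) = tmono im a)))"

lemma iSymAPM_iff: "w \<in> iSymAPM im n \<longleftrightarrow> w \<in> SL n \<and> apm_shape im n w"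
  by (simp add: iSymAPM_def apm_shape_def)

lemma apm_shape_fixed:
  assumes w: "apm_shape im n w" and j: "j < n" "perm_of n w j = j"
  shows "w $$ (j, j) = tmono 1 (expo n w j)"
proof -
  have "monomial_mat n w" using w by (simp add: apm_shape_def)
  from monomial_mat_perm(2)[OF this j(1)] have nz: "w $$ (j, j) \<noteq> 0" by (simp add: j)
  then obtain a where "w $$ (j, j) = tmono 1 a"
    using w j(1) unfolding apm_shape_def by (metis (full_types))
  then show ?thesis by (simp add: expo_def j tmono_subdegree)
qed

lemma apm_shape_cycle:
  fixes im :: "'k::field"
  assumes two: "(2::'k) \<noteq> 0" and im: "im \<noteq> 0"
    and w: "apm_shape im n w" and jk: "(j, k) \<in> two_cycles n w"
  shows "w $$ (j, k) = tmono (if minus_case im n w \<and> j = 0 then - im else im) (expo n w j)"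
    and "w $$ (k, j) = w $$ (j, k)" and "expo n w k = expo n w j"
proof -
  have mw: "monomial_mat n w" and sw: "w\<^sup>T = w" using w by (simp_all add: apm_shape_def)
  have j: "j < k" "k < n" "j < n" "perm_of n w j = k" "perm_of n w k = j"
    using jk by (auto simp: two_cycles_def)
  note m = monomial_mat_perm[OF mw] and i = symmetric_monomial_perm[OF mw sw]
  show e: "w $$ (k, j) = w $$ (j, k)" using i(3)[OF j(3)] j by simp
  show "expo n w k = expo n w j" using i(2)[OF j(3)] j by simp
  have nz: "w $$ (j, k) \<noteq> 0" using m(2)[OF j(2)] j by simp
  have ne: "im \<noteq> - im"
    using two im by (metis add_eq_0_iff mult_2 no_zero_divisors)
  have expo: "expo n w j = a" if "w $$ (j, k) = tmono x a" for x a
    using that nz e j by (auto simp: expo_def tmono_subdegree)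
  have fix_iff: "(\<exists>p<n. w $$ (p, p) \<noteq> 0) \<longleftrightarrow> (\<exists>p<n. perm_of n w p = p)"
    using m(3) by metis
  have "\<exists>a. w $$ (j, k) = tmono (if minus_case im n w \<and> j = 0 then - im else im) a"
  proof (cases "\<exists>p<n. w $$ (p, p) \<noteq> 0")
    case True
    then have "\<not> minus_case im n w" using fix_iff by (auto simp: minus_case_def)
    moreover have "\<exists>a. w $$ (j, k) = tmono im a"
      using w True nz j(1-3) unfolding apm_shape_def by (metis less_irrefl)
    ultimately show ?thesis by simp
  next
    case False
    then have shape: "if j = 0 \<or> k = 0 then \<exists>a. w $$ (j, k) = tmono im a \<or> w $$ (j, k) = tmono (- im) a
              else \<exists>a. w $$ (j, k) = tmono im a"
      using w nz j(2,3) unfolding apm_shape_def by auto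
    show ?thesis
    proof (cases "j = 0")
      case True
      have qk: "q = k" if "q < n" "w $$ (0, q) \<noteq> 0" for q
        using m(3)[OF that(1), of 0] that i(1)[OF that(1)] j True by auto
      have "\<forall>j<n. perm_of n w j \<noteq> j" using False fix_iff by blast
      with qk nz j(2) True have "minus_case im n w \<longleftrightarrow> (\<exists>a. w $$ (0, k) = tmono (- im) a)"
        unfolding minus_case_def by metis
      moreover have "\<not> (\<exists>a. w $$ (0, k) = tmono (- im) a)" if "w $$ (0, k) = tmono im a" for a
        using that im ne by (auto simp: tmono_eq_iff)
      ultimately show ?thesis using shape True by auto
    next
      case False
      then show ?thesis using shape j(1) by simp
    qed
  qed
  then obtain a where a: "w $$ (j, k) = tmono (if minus_case im n w \<and> j = 0 then - im else im) a" ..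
  with expo[OF a] show "w $$ (j, k) = tmono (if minus_case im n w \<and> j = 0 then - im else im) (expo n w j)"
    by simp
qed

section \<open>The explicit representatives\<close>

text \<open>The two-cycles contribute an even number to the sum of the exponents. If this sum is even, then so
  is the number of fixed points with odd exponent, and none of them is left out of the pairing.\<close>

lemma gmat_partition:
  assumes w: "monomial_mat n w" "w\<^sup>T = w" and even: "even (\<Sum>j<n. expo n w j)"
  shows "pair_partition n (even_fixed n w) (odd_pairs n w \<union> two_cycles n w)"
    and "odd_pairs n w \<inter> two_cycles n w = {}"
    and "(j, k) \<in> odd_pairs n w \<Longrightarrow>
      j < k \<and> k < n \<and> perm_of n w j = j \<and> perm_of n w k = k \<and> odd (expo n w j) \<and> odd (expo n w k)"
proof -
  let ?s = "perm_of n w" and ?c = "expo n w"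
  let ?E = "{j. j < n \<and> ?s j = j}" and ?O = "{j. j < n \<and> ?s j = j \<and> odd (?c j)}"
  note pp = perm_partition[OF w]
  have "(\<Sum>j<n. ?c j) = (\<Sum>j\<in>?E. ?c j) + (\<Sum>(j, k)\<in>two_cycles n w. ?c j + ?c k)"
    by (rule sum.pair_partition[OF pp])
  also have "(\<Sum>(j, k)\<in>two_cycles n w. ?c j + ?c k) = 2 * (\<Sum>(j, k)\<in>two_cycles n w. ?c j)"
    unfolding sum_distrib_left
  proof (intro sum.cong refl, safe)
    fix j k assume "(j, k) \<in> two_cycles n w"
    then have "j < n" "k = ?s j" by (auto simp: two_cycles_def)
    then show "?c j + ?c k = 2 * ?c j" using symmetric_monomial_perm(2)[OF w] by simp
  qed
  finally have "even (\<Sum>j\<in>?E. ?c j)" using even by simp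
  then have "even (card {j \<in> ?E. odd (?c j)})"
    by (subst (asm) even_sum_iff) auto
  also have "{j \<in> ?E. odd (?c j)} = ?O" by auto
  finally have "even (card ?O)" .
  then have len: "even (length (odd_fixed n w))" by (simp add: odd_fixed_def)
  have srt: "sorted_wrt (<) (odd_fixed n w)" by (simp add: odd_fixed_def)
  have set: "set (odd_fixed n w) = ?O" by (simp add: odd_fixed_def)
  note cp = consecutive_pairs[OF srt len, folded odd_pairs_def, unfolded set]
  show odd: "j < k \<and> k < n \<and> ?s j = j \<and> ?s k = k \<and> odd (?c j) \<and> odd (?c k)"
    if "(j, k) \<in> odd_pairs n w" for j k
    using cp(1)[OF that] by auto
  have two: "j < k \<and> k < n \<and> ?s j = k \<and> ?s k = j" if "(j, k) \<in> two_cycles n w" for j k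
    using that by (auto simp: two_cycles_def)
  show "odd_pairs n w \<inter> two_cycles n w = {}"
    using odd two by fastforce
  have "\<exists>!jk. jk \<in> odd_pairs n w \<union> two_cycles n w \<and> (p = fst jk \<or> p = snd jk)"
    if p: "p < n" "p \<notin> even_fixed n w" for p
  proof (cases "?s p = p")
    case True
    then have "p \<in> ?O" using p by (auto simp: even_fixed_def)
    have "jk \<notin> two_cycles n w" if "p = fst jk \<or> p = snd jk" for jk
      using two[of "fst jk" "snd jk"] that True by auto
    then have "jk \<in> odd_pairs n w \<union> two_cycles n w \<and> (p = fst jk \<or> p = snd jk) \<longleftrightarrow>
        jk \<in> odd_pairs n w \<and> (p = fst jk \<or> p = snd jk)" for jk
      by blast
    then show ?thesis using cp(2)[OF \<open>p \<in> ?O\<close>] by simp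
  next
    case False
    then have ex: "\<exists>!jk. jk \<in> two_cycles n w \<and> (p = fst jk \<or> p = snd jk)"
      using pp p(1) unfolding pair_partition_def by blast
    have "jk \<notin> odd_pairs n w" if "p = fst jk \<or> p = snd jk" for jk
      using odd[of "fst jk" "snd jk"] that False by auto
    then have "jk \<in> odd_pairs n w \<union> two_cycles n w \<and> (p = fst jk \<or> p = snd jk) \<longleftrightarrow>
        jk \<in> two_cycles n w \<and> (p = fst jk \<or> p = snd jk)" for jk
      by blast
    then show ?thesis using ex by simp
  qed
  moreover have "j < k \<and> k < n \<and> j \<notin> even_fixed n w \<and> k \<notin> even_fixed n w"
    if "(j, k) \<in> odd_pairs n w \<union> two_cycles n w" for j k
    using that odd[of j k] two[of j k] by (auto simp: even_fixed_def)
  ultimately show "pair_partition n (even_fixed n w) (odd_pairs n w \<union> two_cycles n w)"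
    unfolding pair_partition_def by (auto simp: even_fixed_def)
qed

lemma prod_tmono:
  assumes "\<And>i. i \<in> I \<Longrightarrow> \<exists>a. h i = tmono 1 a"
  shows "\<exists>a. (\<Prod>i\<in>I. h i) = tmono 1 a"
  using assms
proof (induction I rule: infinite_finite_induct)
  case (insert i I)
  then obtain a b where "h i = tmono 1 a" "prod h I = tmono 1 b" by (metis insertCI)
  with insert.hyps show ?case by (auto simp: tmono_mult)
next
  case (infinite I)
  then show ?case by (auto intro: exI[of _ 0] simp: tmono_def)
next
  case empty
  show ?case by (auto intro: exI[of _ 0] simp: tmono_def)
qed

lemma block_nonzero:
  "block j k x1 x2 x3 x4 (p, q) \<noteq> 0 \<Longrightarrow> (p = j \<or> p = k) \<and> (q = j \<or> q = k)"
  by (auto simp: block_def split: if_splits)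

lemma block_nth:
  assumes "j \<noteq> k"
  shows "block j k x1 x2 x3 x4 (j, j) = x1" "block j k x1 x2 x3 x4 (j, k) = x2"
    "block j k x1 x2 x3 x4 (k, j) = x3" "block j k x1 x2 x3 x4 (k, k) = x4"
  using assms by (auto simp: block_def)

text \<open>The determinant of \<open>w\<close> is not assumed to be \<open>1\<close>: the conclusion serves to compute it for matrices
  that are not yet known to lie in \<open>SL\<^sub>n\<close>.\<close>

lemma gmat_gram:
  fixes im :: "'k::field" and s :: "'k fps"
  assumes two: "(2::'k) \<noteq> 0" and im: "im ^ 2 = -1" and s: "s ^ 2 = fps_X - 1"
    and w: "apm_shape im n w" and even: "even (\<Sum>j<n. expo n w j)"
  shows "gmat im s n w \<in> carrier_mat n n" "(gmat im s n w)\<^sup>T * gmat im s n w = w"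
    "\<exists>N. det (gmat im s n w) = tmono 1 N"
proof -
  have mw: "monomial_mat n w" and sw: "w\<^sup>T = w" using w by (simp_all add: apm_shape_def)
  have wc: "w \<in> carrier_mat n n" using mw by (simp add: monomial_mat_def)
  have im0: "im \<noteq> 0" using im by auto
  have im2: "im * im = -1" using im by (simp add: power2_eq_square)
  note m = monomial_mat_perm[OF mw] and i = symmetric_monomial_perm[OF mw sw]
  note odd = gmat_partition(3)[OF mw sw even]
  define E where "E = even_fixed n w"
  define P where "P = odd_pairs n w \<union> two_cycles n w"
  have pp: "pair_partition n E P" unfolding E_def P_def by (rule gmat_partition(1)[OF mw sw even])
  note D = pair_partitionD[OF pp]
  define x :: "nat \<Rightarrow> 'k fls" where "x = (\<lambda>j. tmono 1 (expo n w j div 2))"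
  define f where "f = (\<lambda>jk. if jk \<in> two_cycles n w then cycle_block im n w jk else odd_block s n w jk)"
  define G where "G = gmat im s n w"
  show G: "G \<in> carrier_mat n n" by (simp add: G_def gmat_def)
  have f: "(p = j \<or> p = k) \<and> (q = j \<or> q = k)" if "f (j, k) (p, q) \<noteq> 0" for j k p q
    using that by (auto simp: f_def cycle_block_def odd_block_def Let_def split: if_splits dest!: block_nonzero)
  have G_nth: "G $$ (p, q) = (\<Sum>j\<in>E. if (p, q) = (j, j) then x j else 0) + (\<Sum>jk\<in>P. f jk (p, q))"
    if "p < n" "q < n" for p q
  proof -
    have disj: "odd_pairs n w \<inter> two_cycles n w = {}" by (rule gmat_partition(2)[OF mw sw even])
    have "(\<Sum>jk\<in>P. f jk (p, q)) = (\<Sum>jk\<in>odd_pairs n w. f jk (p, q)) + (\<Sum>jk\<in>two_cycles n w. f jk (p, q))"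
      using D(4) disj unfolding P_def by (intro sum.union_disjoint) auto
    also have "(\<Sum>jk\<in>odd_pairs n w. f jk (p, q)) = (\<Sum>jk\<in>odd_pairs n w. odd_block s n w jk (p, q))"
      using disj by (intro sum.cong) (auto simp: f_def)
    also have "(\<Sum>jk\<in>two_cycles n w. f jk (p, q)) = (\<Sum>jk\<in>two_cycles n w. cycle_block im n w jk (p, q))"
      by (intro sum.cong) (auto simp: f_def)
    finally show ?thesis
      using that unfolding G_def gmat_def x_def E_def X_intpow_eq_tmono by (simp add: add.assoc)
  qed
  note bs = block_sum_nth[OF pp, where x = x and f = f, OF f]
  have sG: "G $$ (p, q) = 0" if "p < n" "q < n" "\<not> same_block P p q" for p q
    unfolding G_nth[OF that(1,2)] by (rule bs(3)[OF _ that(3)]) simp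
  have GE: "G $$ (p, p) = tmono 1 (expo n w p div 2)" if "p \<in> E" for p
    unfolding G_nth[OF D(1)[OF that] D(1)[OF that]] using bs(1)[OF _ that] by (simp add: x_def)
  have GP: "G $$ (p, q) = f (j, k) (p, q)" if "(j, k) \<in> P" "p = j \<or> p = k" "q = j \<or> q = k" for j k p q
  proof -
    have "p < n" "q < n" using D(2)[OF that(1)] that(2,3) by auto
    then show ?thesis unfolding G_nth[OF \<open>p < n\<close> \<open>q < n\<close>] by (intro bs(2)[OF _ that]) simp
  qed
  define r where "r = fps_to_fls s"
  have r: "r * r = tmono 1 1 - 1"
  proof -
    have "r * r = fps_to_fls (s ^ 2)" by (simp add: r_def fls_times_fps_to_fls power2_eq_square)
    also have "\<dots> = tmono 1 1 - 1" unfolding s by (simp add: tmono_def fls_X_conv_shift_1)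
    finally show ?thesis .
  qed
  define h where "h = (\<lambda>j. (expo n w j - 1) div 2)"
  have Godd: "G $$ (j, j) = tmono 1 (h j)" "G $$ (j, k) = - (r * tmono 1 (h k))"
    "G $$ (k, j) = tmono 1 (h j) * r" "G $$ (k, k) = tmono 1 (h k)"
    if jk: "(j, k) \<in> odd_pairs n w" for j k
  proof -
    have "(j, k) \<in> P" using jk by (simp add: P_def)
    note gp = GP[OF this]
    have "(j, k) \<notin> two_cycles n w" using odd[OF jk] by (auto simp: two_cycles_def)
    then have f: "f (j, k) = block j k (tmono 1 (h j)) (- (r * tmono 1 (h k))) (tmono 1 (h j) * r) (tmono 1 (h k))"
      unfolding f_def odd_block_def Let_def X_intpow_eq_tmono h_def r_def by simp
    have "j \<noteq> k" using odd[OF jk] by simp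
    note b = block_nth[OF this]
    show "G $$ (j, j) = tmono 1 (h j)" "G $$ (j, k) = - (r * tmono 1 (h k))"
      "G $$ (k, j) = tmono 1 (h j) * r" "G $$ (k, k) = tmono 1 (h k)"
      using gp[of j j] gp[of j k] gp[of k j] gp[of k k] by (simp_all add: f b)
  qed
  define mc where "mc = (\<lambda>j. minus_case im n w \<and> j = (0::nat))"
  define e where "e = expo n w"
  have Gcyc: "G $$ (j, j) = (if mc j then tmono im 0 else tmono (1 / 2) (e j))"
    "G $$ (j, k) = (if mc j then tmono (- 1 / 2) (e j) else tmono im 0)"
    "G $$ (k, j) = (if mc j then tmono 1 0 else tmono (im / 2) (e j))"
    "G $$ (k, k) = (if mc j then tmono (- im / 2) (e j) else tmono 1 0)"
    if jk: "(j, k) \<in> two_cycles n w" for j k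
  proof -
    have "(j, k) \<in> P" using jk by (simp add: P_def)
    note gp = GP[OF this]
    have one: "1 = (tmono 1 0 :: 'k fls)" by (simp add: tmono_def)
    have f: "f (j, k) = (if mc j then block j k (tmono im 0) (tmono (- 1 / 2) (e j)) (tmono 1 0) (tmono (- im / 2) (e j))
       else block j k (tmono (1 / 2) (e j)) (tmono im 0) (tmono (im / 2) (e j)) (tmono 1 0))"
      using jk unfolding f_def cycle_block_def Let_def X_intpow_eq_tmono fls_const_eq_tmono mc_def e_def
      by (simp add: tmono_uminus tmono_mult tmono_halve[OF two] one)
    have "j \<noteq> k" using jk by (auto simp: two_cycles_def)
    note b = block_nth[OF this]
    show "G $$ (j, j) = (if mc j then tmono im 0 else tmono (1 / 2) (e j))"
      "G $$ (j, k) = (if mc j then tmono (- 1 / 2) (e j) else tmono im 0)"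
      "G $$ (k, j) = (if mc j then tmono 1 0 else tmono (im / 2) (e j))"
      "G $$ (k, k) = (if mc j then tmono (- im / 2) (e j) else tmono 1 0)"
      using gp[of j j] gp[of j k] gp[of k j] gp[of k k] by (simp_all add: f b)
  qed
  have hodd: "h j + h j + 1 = e j" if "odd (e j)" for j
    using that by (auto simp: h_def e_def elim: oddE)
  have w0: "w $$ (p, q) = 0" if "p < n" "q < n" "p \<noteq> perm_of n w q" for p q
    using m(3)[OF that(2,1)] that(3) by auto
  have wfix: "w $$ (j, j) = tmono 1 (e j)" if "j < n" "perm_of n w j = j" for j
    unfolding e_def by (rule apm_shape_fixed[OF w that])
  have wcyc: "w $$ (j, k) = tmono (if mc j then - im else im) (e j)" "w $$ (k, j) = w $$ (j, k)"
    if "(j, k) \<in> two_cycles n w" for j k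
    using apm_shape_cycle(1,2)[OF two im0 w that] by (simp_all add: mc_def e_def)
  show "G\<^sup>T * G = w"
  proof (rule gram_block_matrix[OF pp G wc sG])
    fix p q assume pq: "p < n" "q < n" "\<not> same_block P p q"
    have "p \<noteq> perm_of n w q"
    proof
      assume p: "p = perm_of n w q"
      then have "p < q \<Longrightarrow> (p, q) \<in> two_cycles n w" "q < p \<Longrightarrow> (q, p) \<in> two_cycles n w"
        using pq i(1)[OF pq(2)] by (auto simp: two_cycles_def)
      then show False using pq(3) by (cases p q rule: linorder_cases) (auto simp: same_block_def P_def)
    qed
    then show "w $$ (p, q) = 0" using w0 pq by blast
  next
    fix p assume p: "p \<in> E"
    then have "p < n" "perm_of n w p = p" "even (e p)" by (auto simp: E_def e_def even_fixed_def)
    then show "G $$ (p, p) * G $$ (p, p) = w $$ (p, p)"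
      using wfix[of p] by (auto simp: GE[OF p] tmono_mult e_def[symmetric] elim: evenE)
  next
    fix j k p q assume jk: "(j, k) \<in> P" and p: "p = j \<or> p = k" and q: "q = j \<or> q = k"
    show "G $$ (j, p) * G $$ (j, q) + G $$ (k, p) * G $$ (k, q) = w $$ (p, q)"
    proof (cases "(j, k) \<in> odd_pairs n w")
      case True
      note o = odd[OF True]
      have sq: "tmono 1 (h l) * tmono 1 (h l) + (tmono 1 (h l) * r) * (tmono 1 (h l) * r) = tmono 1 (e l)"
        if "odd (e l)" for l
      proof -
        have "tmono 1 (h l) * tmono 1 (h l) + (tmono 1 (h l) * r) * (tmono 1 (h l) * r) =
            tmono 1 (h l) * tmono 1 (h l) * (1 + r * r)"
          by (simp add: algebra_simps)
        also have "\<dots> = tmono 1 (e l)"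
          using hodd[OF that] by (simp add: r tmono_mult)
        finally show ?thesis .
      qed
      have "w $$ (j, j) = tmono 1 (e j)" "w $$ (k, k) = tmono 1 (e k)" "w $$ (j, k) = 0" "w $$ (k, j) = 0"
        using wfix w0 o by auto
      moreover have "odd (e j)" "odd (e k)" using o by (auto simp: e_def)
      ultimately show ?thesis
        using p q sq by (auto simp: Godd[OF True] algebra_simps)
    next
      case False
      then have jk2: "(j, k) \<in> two_cycles n w" using jk by (simp add: P_def)
      then have "j < n" "k < n" "perm_of n w j = k" "j \<noteq> k" "perm_of n w k = j"
        by (auto simp: two_cycles_def)
      then have z: "w $$ (j, j) = 0" "w $$ (k, k) = 0" using w0 by auto
      have half: "im / 2 + im / 2 = im" "1 / 2 + 1 / 2 = (1 :: 'k)" using two by (simp_all add: field_simps)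
      show ?thesis
        using p q wcyc[OF jk2] half
        by (auto simp: Gcyc[OF jk2] z tmono_mult tmono_add im2)
    qed
  qed
  have "det G = (\<Prod>j\<in>E. G $$ (j, j)) *
    (\<Prod>(j, k)\<in>P. G $$ (j, j) * G $$ (k, k) - G $$ (j, k) * G $$ (k, j))"
  proof (rule det_block_matrix[OF pp G sG])
    fix j k assume "(j, k) \<in> P"
    then show "G $$ (j, j) \<noteq> 0" using Godd(1)[of j k] Gcyc(1)[of j k] im0 two
      by (auto simp: P_def split: if_splits)
  qed
  moreover have "\<exists>a. (\<Prod>j\<in>E. G $$ (j, j)) = tmono 1 a"
    using GE by (intro prod_tmono) auto
  moreover have "\<exists>a. (\<Prod>(j, k)\<in>P. G $$ (j, j) * G $$ (k, k) - G $$ (j, k) * G $$ (k, j)) = tmono 1 a"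
  proof (rule prod_tmono, clarify)
    fix j k assume jk: "(j, k) \<in> P"
    show "\<exists>a. G $$ (j, j) * G $$ (k, k) - G $$ (j, k) * G $$ (k, j) = tmono 1 a"
    proof (cases "(j, k) \<in> odd_pairs n w")
      case True
      have "G $$ (j, j) * G $$ (k, k) - G $$ (j, k) * G $$ (k, j) = tmono 1 (h j) * tmono 1 (h k) * (1 + r * r)"
        by (simp add: Godd[OF True] algebra_simps)
      also have "\<dots> = tmono 1 (h j + h k + 1)" by (simp add: r tmono_mult)
      finally show ?thesis by blast
    next
      case False
      then have jk2: "(j, k) \<in> two_cycles n w" using jk by (simp add: P_def)
      have half: "1 / 2 + 1 / 2 = (1 :: 'k)" using two by (simp add: field_simps)
      have "G $$ (j, j) * G $$ (k, k) - G $$ (j, k) * G $$ (k, j) = tmono 1 (e j)"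
        using half by (auto simp: Gcyc[OF jk2] tmono_mult tmono_diff im2)
      then show ?thesis by blast
    qed
  qed
  ultimately show "\<exists>N. det G = tmono 1 N" by (auto simp: tmono_mult)
qed

lemma iSymAPM_sum_expo:
  assumes "w \<in> iSymAPM im n"
  shows "(\<Sum>j<n. expo n w j) = 0"
  using assms by (intro det_symmetric_monomial) (auto simp: iSymAPM_iff apm_shape_def SL_def)

lemma gmat_iSymAPM:
  fixes im :: "'k::field" and s :: "'k fps"
  assumes two: "(2::'k) \<noteq> 0" and im: "im ^ 2 = -1" and s: "s ^ 2 = fps_X - 1"
    and w: "w \<in> iSymAPM im n"
  shows "gmat im s n w \<in> SL n" "(gmat im s n w)\<^sup>T * gmat im s n w = w"
proof -
  let ?G = "gmat im s n w"
  have shape: "apm_shape im n w" and det: "det w = 1" using w by (auto simp: iSymAPM_iff SL_def)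
  have ev: "even (\<Sum>j<n. expo n w j)" using iSymAPM_sum_expo[OF w] by simp
  note G = gmat_gram[OF two im s shape ev]
  show "?G\<^sup>T * ?G = w" by (rule G(2))
  obtain N where N: "det ?G = tmono 1 N" using G(3) by blast
  have "det ?G * det ?G = 1"
    using det det_mult[of "?G\<^sup>T" n ?G] det_transpose[OF G(1)] G(1,2) by simp
  then have "tmono (1::'k) (N + N) = 1" unfolding N tmono_mult by simp
  also have "\<dots> = tmono 1 0" by (simp add: tmono_def)
  finally have "tmono (1::'k) (N + N) = tmono 1 0" .
  then have "N = 0" by (simp add: tmono_eq_iff)
  then have "det ?G = 1" by (simp add: N tmono_def)
  then show "?G \<in> SL n" using G(1) by (simp add: SL_def)
qed

section \<open>Distinct index matrices are not congruent\<close>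

text \<open>Write \<open>w\<close> and \<open>w'\<close> also for the underlying involutions, \<open>e\<close> and \<open>e'\<close> for the exponents, and
  \<open>t(q) = w(w'(q))\<close>. With \<open>c = b\<inverse>\<close> the congruence reads \<open>c\<^sup>T w' = w b\<close>, and its entry in row
  \<open>w'(q)\<close> and column \<open>q\<close> shows that \<open>e'(q) - e(t(q))\<close> is at least \<open>0\<close>, and at least \<open>1\<close> if \<open>q < t(q)\<close>.
  These differences sum to \<open>0\<close>, so all of them vanish and \<open>t(q) \<le> q\<close> for all \<open>q\<close>; a bijection with
  this property is the identity. The last conclusion records the entry once \<open>t\<close> is known to be the
  identity.\<close>

lemma congruent_monomial:
  assumes w: "monomial_mat n w" "w\<^sup>T = w" "(\<Sum>j<n. expo n w j) = 0"
    and w': "monomial_mat n w'" "w'\<^sup>T = w'" "(\<Sum>j<n. expo n w' j) = 0"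
    and b: "b \<in> Iwahori n" and eq: "w' = b\<^sup>T * w * b"
  shows "q < n \<Longrightarrow> perm_of n w' q = perm_of n w q" and "q < n \<Longrightarrow> expo n w' q = expo n w q"
    and "q < n \<Longrightarrow> \<exists>c. c \<in> frac_ideal 0 \<and> fls_nth c 0 * fls_nth (b $$ (perm_of n w q, perm_of n w q)) 0 = 1
           \<and> c * w' $$ (perm_of n w q, q) = w $$ (perm_of n w q, q) * b $$ (q, q)"
proof -
  obtain c where c: "c \<in> Iwahori n" and cb: "c * b = 1\<^sub>m n" "b * c = 1\<^sub>m n"
    by (rule Iwahori_inverse[OF b])
  have bG: "b \<in> GL_Iwahori n" and cG: "c \<in> GL_Iwahori n" using b c by (auto simp: Iwahori_eq)
  note bD = GL_IwahoriD[OF bG] and cD = GL_IwahoriD[OF cG]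
  have wc: "w \<in> carrier_mat n n" and wc': "w' \<in> carrier_mat n n"
    using w w' by (simp_all add: monomial_mat_def)
  note m = monomial_mat_perm[OF w(1)] and i = symmetric_monomial_perm[OF w(1,2)]
  note m' = monomial_mat_perm[OF w'(1)] and i' = symmetric_monomial_perm[OF w'(1,2)]
  let ?s = "perm_of n w" and ?s' = "perm_of n w'"
  have "c\<^sup>T * w' = c\<^sup>T * (b\<^sup>T * (w * b))"
    unfolding eq using bD(1) wc by (subst assoc_mult_mat[of _ n n _ n _ n]) auto
  also have "\<dots> = (c\<^sup>T * b\<^sup>T) * (w * b)"
    using bD(1) cD(1) wc by (subst assoc_mult_mat[of _ n n _ n _ n]) auto
  also have "c\<^sup>T * b\<^sup>T = 1\<^sub>m n"
    using transpose_mult[OF bD(1) cD(1)] cb(2) by simp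
  finally have cw: "c\<^sup>T * w' = w * b" using bD(1) wc by simp
  have entry: "c $$ (?s' q, p) * w' $$ (?s' q, q) = w $$ (p, ?s p) * b $$ (?s p, q)"
    if p: "p < n" and q: "q < n" for p q
  proof -
    have "(c\<^sup>T * w') $$ (p, q) = (\<Sum>l<n. c\<^sup>T $$ (p, l) * w' $$ (l, q))"
      using cD(1) wc' p q by (intro mult_mat_nth) auto
    also have "\<dots> = (\<Sum>l\<in>{?s' q}. c\<^sup>T $$ (p, l) * w' $$ (l, q))"
      using m'[OF q] by (intro sum.mono_neutral_right) auto
    finally have l: "(c\<^sup>T * w') $$ (p, q) = c $$ (?s' q, p) * w' $$ (?s' q, q)"
      using cD(1) m'(1)[OF q] p by simp
    have "w $$ (p, l) = 0" if "l < n" "l \<noteq> ?s p" for l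
      using m(3)[OF that(1) p] i(1)[OF that(1)] that by auto
    then have "(\<Sum>l<n. w $$ (p, l) * b $$ (l, q)) = (\<Sum>l\<in>{?s p}. w $$ (p, l) * b $$ (l, q))"
      using m(1)[OF p] by (intro sum.mono_neutral_right) auto
    then have "(w * b) $$ (p, q) = w $$ (p, ?s p) * b $$ (?s p, q)"
      using mult_mat_nth[OF wc bD(1) p q] by simp
    with l cw show ?thesis by simp
  qed
  define t where "t = (\<lambda>q. ?s (?s' q))"
  have t: "t q < n" if "q < n" for q using m m' that by (simp add: t_def)
  have bij: "bij_betw t {..<n} {..<n}"
    by (rule bij_betw_byWitness[of _ "\<lambda>q. ?s' (?s q)"]) (use m m' i i' in \<open>auto simp: t_def\<close>)
  \<comment> \<open>Orders are compared in the entry of \<open>c\<^sup>T w' = w b\<close> in row \<open>?s' q\<close> and column \<open>q\<close>; the diagonal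
    entry of \<open>c\<close> on the left is a unit, and an entry of \<open>b\<close> below the diagonal has positive order.\<close>
  have ge: "expo n w (t q) + (if q < t q then 1 else 0) \<le> expo n w' q" if q: "q < n" for q
  proof -
    have p: "?s' q < n" by (rule m'(1)[OF q])
    have c0: "c $$ (?s' q, ?s' q) \<noteq> 0" "fls_subdegree (c $$ (?s' q, ?s' q)) = 0"
      using cD(2)[OF p p] cD(4)[OF p] by (auto simp: frac_ideal_def intro: antisym fls_subdegree_leI)
    have w0: "w $$ (?s' q, t q) \<noteq> 0" "fls_subdegree (w $$ (?s' q, t q)) = expo n w (t q)"
      using m(2)[OF p] i(3)[OF p] i(2)[OF p] by (simp_all add: t_def expo_def)
    have e: "c $$ (?s' q, ?s' q) * w' $$ (?s' q, q) = w $$ (?s' q, t q) * b $$ (t q, q)"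
      using entry[OF p q] by (simp add: t_def)
    then have b0: "b $$ (t q, q) \<noteq> 0" using c0(1) m'(2)[OF q] by auto
    have "expo n w' q = fls_subdegree (c $$ (?s' q, ?s' q) * w' $$ (?s' q, q))"
      using c0 m'(2)[OF q] by (simp add: expo_def)
    also have "\<dots> = expo n w (t q) + fls_subdegree (b $$ (t q, q))"
      unfolding e using w0 b0 by simp
    finally show ?thesis
      using bD(2)[OF t[OF q] q] bD(3)[OF _ t[OF q], of q] b0 by (auto simp: frac_ideal_def)
  qed
  have sum: "(\<Sum>q<n. expo n w (t q)) = (\<Sum>q<n. expo n w' q)"
    using sum.reindex_bij_betw[OF bij, of "expo n w"] w(3) w'(3) by simp
  have le: "expo n w (t q) \<le> expo n w' q" if "q < n" for q
    using ge[OF that] by (auto split: if_splits)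
  have e: "expo n w (t q) = expo n w' q" if "q < n" for q
    by (rule sum_mono_inv[OF sum]) (use le that in auto)
  then have tle: "t q \<le> q" if "q < n" for q
    using ge[OF that] that by (auto split: if_splits)
  have "(\<Sum>q<n. t q) = (\<Sum>q<n. q)" by (rule sum.reindex_bij_betw[OF bij, of "\<lambda>q. q"])
  then have tid: "t q = q" if "q < n" for q
    by (rule sum_mono_inv) (use tle that in auto)
  show s: "?s' q = ?s q" if "q < n" for q
    using i(1)[OF m'(1)[OF that]] tid[OF that] by (simp add: t_def)
  show "expo n w' q = expo n w q" if "q < n" for q using e[OF that] tid[OF that] by simp
  show "\<exists>c. c \<in> frac_ideal 0 \<and> fls_nth c 0 * fls_nth (b $$ (?s q, ?s q)) 0 = 1
           \<and> c * w' $$ (?s q, q) = w $$ (?s q, q) * b $$ (q, q)" if q: "q < n"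
  proof -
    have p: "?s q < n" by (rule m(1)[OF q])
    have "fls_nth (c $$ (?s q, ?s q)) 0 * fls_nth (b $$ (?s q, ?s q)) 0 = 1"
      using GL_Iwahori_diag_mult[OF cG bG p] cb(1) p by simp
    moreover have "c $$ (?s q, ?s q) * w' $$ (?s q, q) = w $$ (?s q, q) * b $$ (q, q)"
      using entry[OF p q] s[OF q] i(1)[OF q] by simp
    ultimately show ?thesis using cD(2)[OF p p] by blast
  qed
qed

text \<open>Once underlying permutations and exponents agree, two index matrices can differ only in the
  sign in the first row. That sign is the product of the signs of all two-cycles, and a congruence by
  \<open>b\<close> multiplies it by the constant term of the product of the diagonal entries of \<open>b\<close>, which is
  that of \<open>det b = 1\<close>.\<close>

lemma congruent_minus_case:
  fixes im :: "'k::field"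
  assumes n: "n > 0" and two: "(2::'k) \<noteq> 0" and im0: "im \<noteq> 0"
    and w: "w \<in> iSymAPM im n" and w': "w' \<in> iSymAPM im n"
    and b: "b \<in> Iwahori n" and eq: "w' = b\<^sup>T * w * b" and nofix: "\<And>q. q < n \<Longrightarrow> perm_of n w q \<noteq> q"
  shows "minus_case im n w = minus_case im n w'"
proof -
  have sh: "apm_shape im n w" and sh': "apm_shape im n w'" using w w' by (auto simp: iSymAPM_iff)
  then have mw: "monomial_mat n w" "w\<^sup>T = w" and mw': "monomial_mat n w'" "w'\<^sup>T = w'"
    by (simp_all add: apm_shape_def)
  note cm = congruent_monomial[OF mw iSymAPM_sum_expo[OF w] mw' iSymAPM_sum_expo[OF w'] b eq]
  have bG: "b \<in> GL_Iwahori n" and det: "det b = 1" using b by (auto simp: Iwahori_eq SL_def)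
  note bD = GL_IwahoriD[OF bG]
  let ?P = "two_cycles n w"
  have P': "two_cycles n w' = ?P"
    using cm(1) by (auto simp: two_cycles_def) (metis less_trans)+
  define beta where "beta = (\<lambda>q. fls_nth (b $$ (q, q)) 0)"
  define sg where "sg = (\<lambda>v (jk :: nat \<times> nat). if minus_case im n v \<and> fst jk = (0::nat) then - 1 else (1::'k))"
  have sg: "(\<Prod>jk\<in>?P. sg v jk) = (if minus_case im n v then - 1 else 1)" for v
  proof (cases "minus_case im n v")
    case True
    let ?z = "(0, perm_of n w 0)"
    have z: "?z \<in> ?P"
      using monomial_mat_perm(1)[OF mw(1) n] symmetric_monomial_perm(1)[OF mw n] nofix[OF n] n
      by (auto simp: two_cycles_def)
    have "(\<Prod>jk\<in>?P. sg v jk) = (\<Prod>jk\<in>?P. if jk = ?z then - 1 else 1)"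
      using True by (intro prod.cong) (auto simp: sg_def two_cycles_def)
    also have "\<dots> = - 1"
      using z pair_partitionD(4)[OF perm_partition[OF mw]] by simp
    finally show ?thesis using True by simp
  qed (simp add: sg_def)
  have rel: "sg w' (j, k) = sg w (j, k) * (beta j * beta k)" if jk: "(j, k) \<in> ?P" for j k
  proof -
    have j: "j < n" "k < n" "perm_of n w k = j" using jk by (auto simp: two_cycles_def)
    obtain c where c: "c \<in> frac_ideal 0" "fls_nth c 0 * beta j = 1"
      and e: "c * w' $$ (j, k) = w $$ (j, k) * b $$ (k, k)"
      using cm(3)[OF j(2)] unfolding j(3) beta_def by blast
    have wjk: "v $$ (j, k) = fls_const (sg v (j, k)) * tmono im (expo n w j)"
      if "apm_shape im n v" "(j, k) \<in> two_cycles n v" "expo n v j = expo n w j" for v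
      using apm_shape_cycle(1)[OF two im0 that(1,2)] that(3)
      by (auto simp: sg_def tmono_uminus)
    have "tmono im (expo n w j) * (c * fls_const (sg w' (j, k))) =
        tmono im (expo n w j) * (fls_const (sg w (j, k)) * b $$ (k, k))"
      using e wjk[OF sh jk] wjk[OF sh'] P' jk cm(2)[OF j(1)] by (simp add: mult_ac)
    then have "c * fls_const (sg w' (j, k)) = fls_const (sg w (j, k)) * b $$ (k, k)"
      using im0 by simp
    then have "fls_nth c 0 * sg w' (j, k) = sg w (j, k) * beta k"
      using nth0_mult[OF c(1), of "fls_const (sg w' (j, k))"]
        nth0_mult[of "fls_const (sg w (j, k))" "b $$ (k, k)"] bD(2)[OF j(2) j(2)]
      by (simp add: beta_def frac_ideal_def)
    then have "fls_nth c 0 * beta j * sg w' (j, k) = sg w (j, k) * (beta j * beta k)"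
      by (simp add: mult_ac)
    then show ?thesis using c(2) by simp
  qed
  have "{j. j < n \<and> perm_of n w j = j} = {}" using nofix by auto
  from prod.pair_partition[OF perm_partition[OF mw], of beta, unfolded this]
  have "(\<Prod>q<n. beta q) = (\<Prod>(j, k)\<in>?P. beta j * beta k)" by simp
  moreover have "(\<Prod>q<n. beta q) = 1"
    using GL_Iwahori_det(2)[OF bG] det by (simp add: beta_def)
  moreover have "(\<Prod>jk\<in>?P. sg w' jk) = (\<Prod>jk\<in>?P. sg w jk) * (\<Prod>(j, k)\<in>?P. beta j * beta k)"
    unfolding prod.distrib[symmetric] using rel by (intro prod.cong) auto
  ultimately have "(if minus_case im n w' then - 1 else 1) = (if minus_case im n w then - 1 else (1::'k))"
    by (simp add: sg)
  moreover have "(- 1 :: 'k) \<noteq> 1"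
    using two by (metis one_add_one add.right_inverse)
  ultimately show ?thesis by (auto split: if_splits)
qed

lemma congruent_iSymAPM_eq:
  fixes im :: "'k::field"
  assumes n: "n > 0" and two: "(2::'k) \<noteq> 0" and im0: "im \<noteq> 0"
    and w: "w \<in> iSymAPM im n" and w': "w' \<in> iSymAPM im n"
    and b: "b \<in> Iwahori n" and eq: "w' = b\<^sup>T * w * b"
  shows "w' = w"
proof -
  have sh: "apm_shape im n w" and sh': "apm_shape im n w'" using w w' by (auto simp: iSymAPM_iff)
  then have mw: "monomial_mat n w" "w\<^sup>T = w" and mw': "monomial_mat n w'" "w'\<^sup>T = w'"
    by (simp_all add: apm_shape_def)
  have wc: "w \<in> carrier_mat n n" and wc': "w' \<in> carrier_mat n n"
    using mw mw' by (simp_all add: monomial_mat_def)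
  note cm = congruent_monomial[OF mw iSymAPM_sum_expo[OF w] mw' iSymAPM_sum_expo[OF w'] b eq]
  have mc: "minus_case im n w = minus_case im n w'"
  proof (cases "\<forall>q<n. perm_of n w q \<noteq> q")
    case True
    then show ?thesis using congruent_minus_case[OF n two im0 w w' b eq] by blast
  next
    case False
    then show ?thesis using cm(1) by (auto simp: minus_case_def)
  qed
  have P': "two_cycles n w' = two_cycles n w"
    using cm(1) by (auto simp: two_cycles_def) (metis less_trans)+
  have cyc: "w' $$ (j, k) = w $$ (j, k) \<and> w' $$ (k, j) = w $$ (k, j)" if jk: "(j, k) \<in> two_cycles n w" for j k
  proof -
    have jk': "(j, k) \<in> two_cycles n w'" using jk P' by simp
    have "j < n" using jk by (auto simp: two_cycles_def)
    then show ?thesis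
      using apm_shape_cycle(1,2)[OF two im0 sh jk] apm_shape_cycle(1,2)[OF two im0 sh' jk'] mc cm(2)
      by simp
  qed
  show ?thesis
  proof (rule eq_matI)
    fix p q assume "p < dim_row w" "q < dim_col w"
    then have p: "p < n" and q: "q < n" using wc by auto
    show "w' $$ (p, q) = w $$ (p, q)"
    proof (cases "p = perm_of n w q")
      case True
      have pq: "perm_of n w p = q" using symmetric_monomial_perm(1)[OF mw q] True by simp
      consider "p = q" | "(p, q) \<in> two_cycles n w" | "(q, p) \<in> two_cycles n w"
        using p q pq True by (cases p q rule: linorder_cases) (auto simp: two_cycles_def)
      then show ?thesis
      proof cases
        case 1
        then show ?thesis
          using apm_shape_fixed[OF sh q] apm_shape_fixed[OF sh' q] cm(1,2)[OF q] True by simp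
      qed (use cyc in auto)
    next
      case False
      then have "w $$ (p, q) = 0" "w' $$ (p, q) = 0"
        using monomial_mat_perm(3)[OF mw(1) q p] monomial_mat_perm(3)[OF mw'(1) q p] cm(1)[OF q] by auto
      then show ?thesis by simp
    qed
  qed (use wc wc' in auto)
qed

section \<open>Every symmetric matrix of determinant one is congruent to an index matrix\<close>

lemma two_nonzero_of_quadratically_closed:
  assumes "quadratically_closed TYPE('k::field)"
  shows "(2::'k) \<noteq> 0"
proof
  assume "(2::'k) = 0"
  then have "of_nat 2 = (0::'k)" by simp
  then have "CHAR('k) dvd 2" unfolding of_nat_eq_0_iff_char_dvd .
  then have "CHAR('k) = 1 \<or> CHAR('k) = 2" using two_is_prime_nat by (auto simp: prime_nat_iff)
  with assms show False by (simp add: quadratically_closed_def)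
qed

lemma fls_unit_sqrt:
  fixes y :: "'k::field fls"
  assumes qc: "quadratically_closed TYPE('k)" and y: "y \<noteq> 0" "fls_subdegree y = 0"
  shows "\<exists>x. x * x = y \<and> x \<noteq> 0 \<and> fls_subdegree x = 0"
proof -
  have y0: "y \<in> frac_ideal 0" using y by (simp add: frac_ideal_def)
  have "fls_nth y 0 \<noteq> 0" using y nth_fls_subdegree_nonzero[of y] by simp
  moreover obtain c where c: "c ^ 2 = fls_nth y 0" using qc by (auto simp: quadratically_closed_def)
  ultimately have "c \<noteq> 0" by auto
  then obtain g where g: "g ^ 2 = fls_regpart y"
    using fps_sqrt_exists[OF two_nonzero_of_quadratically_closed[OF qc], of c "fls_regpart y"] c by auto
  have "fps_to_fls g * fps_to_fls g = fps_to_fls (g ^ 2)"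
    by (simp add: fls_times_fps_to_fls power2_eq_square)
  then have "fps_to_fls g * fps_to_fls g = y" unfolding g fps_to_fls_regpart[OF y0] .
  moreover from this have "fps_to_fls g \<noteq> 0" using y by auto
  moreover from calculation have "fls_subdegree (fps_to_fls g) = 0"
    using fls_subdegree_mult[of "fps_to_fls g" "fps_to_fls g"] y by simp
  ultimately show ?thesis by blast
qed

lemma mat_diag_in_GL_Iwahori:
  assumes "\<And>i. i < n \<Longrightarrow> d i \<noteq> 0 \<and> fls_subdegree (d i) = 0"
  shows "mat_diag n d \<in> GL_Iwahori n"
proof (rule GL_IwahoriI)
  show "mat_diag n d $$ (i, i) \<in> frac_ideal 0 \<and> fls_nth (mat_diag n d $$ (i, i)) 0 \<noteq> 0" if "i < n" for i
    using assms[OF that] nth_fls_subdegree_nonzero[of "d i"] that by (simp add: mat_diag_def frac_ideal_def)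
qed (auto simp: mat_diag_def)

lemma mat_diag_congruence_nth:
  fixes T :: "'a::comm_ring_1 mat"
  assumes T: "T \<in> carrier_mat n n" and "i < n" "j < n"
  shows "((mat_diag n d)\<^sup>T * T * mat_diag n d) $$ (i, j) = d i * T $$ (i, j) * d j"
proof -
  have t: "(mat_diag n d)\<^sup>T = mat_diag n d" by (rule eq_matI) (auto simp: mat_diag_def)
  have "mat_diag n d * T \<in> carrier_mat n n" by (rule mult_carrier_mat[OF mat_diag_dim T])
  from mat_diag_mult_right[OF this] show ?thesis
    unfolding t using assms by (simp add: mat_diag_mult_left[OF T])
qed

lemma monomial_mat_cong:
  assumes "monomial_mat n T" "w \<in> carrier_mat n n"
    and "\<And>p q. p < n \<Longrightarrow> q < n \<Longrightarrow> w $$ (p, q) \<noteq> 0 \<longleftrightarrow> T $$ (p, q) \<noteq> 0"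
  shows "monomial_mat n w"
proof -
  have "(\<exists>!q. q < n \<and> w $$ (p, q) \<noteq> 0) \<longleftrightarrow> (\<exists>!q. q < n \<and> T $$ (p, q) \<noteq> 0)" if "p < n" for p
    using assms(3)[OF that] by (metis (no_types, lifting))
  moreover have "(\<exists>!p. p < n \<and> w $$ (p, q) \<noteq> 0) \<longleftrightarrow> (\<exists>!p. p < n \<and> T $$ (p, q) \<noteq> 0)" if "q < n" for q
    using assms(3)[OF _ that] by (metis (no_types, lifting))
  ultimately show ?thesis using assms(1,2) by (simp add: monomial_mat_def)
qed

text \<open>Rescaling the basis vectors by units makes all diagonal entries powers of \<open>t\<close> and all others
  \<open>im\<close> times a power of \<open>t\<close>.\<close>

lemma normalise_monomial:
  fixes im :: "'k::field"
  assumes qc: "quadratically_closed TYPE('k)" and im0: "im \<noteq> 0"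
    and T: "monomial_mat n T" "T\<^sup>T = T"
  obtains d where "d \<in> GL_Iwahori n" "monomial_mat n (d\<^sup>T * T * d)"
    "\<And>p. p < n \<Longrightarrow> (d\<^sup>T * T * d) $$ (p, p) \<noteq> 0 \<Longrightarrow> \<exists>a. (d\<^sup>T * T * d) $$ (p, p) = tmono 1 a"
    "\<And>p q. p < n \<Longrightarrow> q < n \<Longrightarrow> p \<noteq> q \<Longrightarrow> (d\<^sup>T * T * d) $$ (p, q) \<noteq> 0 \<Longrightarrow>
      \<exists>a. (d\<^sup>T * T * d) $$ (p, q) = tmono im a"
proof -
  have Tc: "T \<in> carrier_mat n n" using T by (simp add: monomial_mat_def)
  note m = monomial_mat_perm[OF T(1)] and i = symmetric_monomial_perm[OF T]
  let ?s = "perm_of n T"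
  have "\<exists>x. x \<noteq> 0 \<and> fls_subdegree x = 0 \<and>
      (?s p = p \<longrightarrow> x * T $$ (p, p) * x = tmono 1 (expo n T p)) \<and>
      (p < ?s p \<longrightarrow> x * T $$ (p, ?s p) = tmono im (expo n T p)) \<and> (?s p < p \<longrightarrow> x = 1)"
    if p: "p < n" for p
  proof -
    have Tp: "T $$ (?s p, p) \<noteq> 0" by (rule m(2)[OF p])
    have sd: "fls_subdegree (tmono c (expo n T p) / T $$ (?s p, p)) = 0" if "c \<noteq> 0" for c
      using Tp that tmono_subdegree[OF that, of "expo n T p"]
      by (simp add: divide_inverse nonzero_imp_inverse_nonzero) (simp add: expo_def)
    consider "?s p = p" | "p < ?s p" | "?s p < p" by linarith
    then show ?thesis
    proof cases
      case 1
      obtain x where "x * x = tmono 1 (expo n T p) / T $$ (?s p, p)" "x \<noteq> 0" "fls_subdegree x = 0"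
        using fls_unit_sqrt[OF qc _ sd[of 1]] Tp by auto
      moreover from this have "x * T $$ (p, p) * x = tmono 1 (expo n T p)"
        using Tp 1 by (simp add: field_simps)
      ultimately show ?thesis using 1 by auto
    next
      case 2
      then show ?thesis
        using sd[OF im0] Tp im0 i(3)[OF p] by (intro exI[of _ "tmono im (expo n T p) / T $$ (?s p, p)"]) auto
    next
      case 3
      then show ?thesis by (intro exI[of _ 1]) auto
    qed
  qed
  then obtain x where x: "\<And>p. p < n \<Longrightarrow> x p \<noteq> 0 \<and> fls_subdegree (x p) = 0"
    and x1: "\<And>p. p < n \<Longrightarrow> ?s p = p \<Longrightarrow> x p * T $$ (p, p) * x p = tmono 1 (expo n T p)"
    and x2: "\<And>p. p < n \<Longrightarrow> p < ?s p \<Longrightarrow> x p * T $$ (p, ?s p) = tmono im (expo n T p)"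
    and x3: "\<And>p. p < n \<Longrightarrow> ?s p < p \<Longrightarrow> x p = 1"
    by metis
  define d where "d = mat_diag n x"
  define w where "w = d\<^sup>T * T * d"
  have d: "d \<in> GL_Iwahori n" unfolding d_def by (rule mat_diag_in_GL_Iwahori) (rule x)
  have w: "w $$ (p, q) = x p * T $$ (p, q) * x q" if "p < n" "q < n" for p q
    unfolding w_def d_def by (rule mat_diag_congruence_nth[OF Tc that])
  have wc: "w \<in> carrier_mat n n" using GL_IwahoriD(1)[OF d] Tc by (simp add: w_def)
  have supp: "w $$ (p, q) \<noteq> 0 \<longleftrightarrow> T $$ (p, q) \<noteq> 0" if "p < n" "q < n" for p q
    using w[OF that] x[OF that(1)] x[OF that(2)] by simp
  have mw: "monomial_mat n w" by (rule monomial_mat_cong[OF T(1) wc supp])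
  have diag: "\<exists>a. w $$ (p, p) = tmono 1 a" if p: "p < n" "w $$ (p, p) \<noteq> 0" for p
    using x1[OF p(1)] m(3)[OF p(1,1)] supp[OF p(1,1)] p(2) w[OF p(1,1)] by auto
  have off: "\<exists>a. w $$ (p, q) = tmono im a" if pq: "p < n" "q < n" "p \<noteq> q" "w $$ (p, q) \<noteq> 0" for p q
  proof -
    have p: "p = ?s q" using m(3)[OF pq(2,1)] supp[OF pq(1,2)] pq(4) by simp
    then have q: "q = ?s p" using i(1)[OF pq(2)] by simp
    show ?thesis
    proof (cases "p < q")
      case True
      then have "x q = 1" using x3[OF pq(2)] p by simp
      then show ?thesis using x2[OF pq(1)] q True w[OF pq(1,2)] by auto
    next
      case False
      then have "q < p" using pq(3) by simp
      then have "x p = 1" using x3[OF pq(1)] q by simp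
      then show ?thesis
        using x2[OF pq(2)] p \<open>q < p\<close> w[OF pq(1,2)] i(3)[OF pq(2)] by (auto simp: mult.commute)
    qed
  qed
  show ?thesis using that[of d] d mw diag off unfolding w_def by blast
qed

lemma congruent_to_iSymAPM:
  fixes im :: "'k::field" and s :: "'k fps" and S :: "'k fls mat"
  assumes n: "n > 0" and qc: "quadratically_closed TYPE('k)" and im: "im ^ 2 = -1"
    and s: "s ^ 2 = fps_X - 1"
    and S: "S \<in> carrier_mat n n" "S\<^sup>T = S" "det S = 1"
  obtains b where "b \<in> Iwahori n" "b\<^sup>T * S * b \<in> iSymAPM im n"
proof -
  have two: "(2::'k) \<noteq> 0" by (rule two_nonzero_of_quadratically_closed[OF qc])
  have im0: "im \<noteq> 0" using im by auto
  obtain b1 where b1: "b1 \<in> GL_Iwahori n" and mT: "monomial_mat n (b1\<^sup>T * S * b1)"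
    using congruent_to_monomial[OF two S(1,2)] S(3) by auto
  have b1c: "b1 \<in> carrier_mat n n" by (rule GL_IwahoriD(1)[OF b1])
  obtain d where d: "d \<in> GL_Iwahori n" and w0: "monomial_mat n (d\<^sup>T * (b1\<^sup>T * S * b1) * d)"
    "\<And>p. p < n \<Longrightarrow> (d\<^sup>T * (b1\<^sup>T * S * b1) * d) $$ (p, p) \<noteq> 0 \<Longrightarrow>
       \<exists>a. (d\<^sup>T * (b1\<^sup>T * S * b1) * d) $$ (p, p) = tmono 1 a"
    "\<And>p q. p < n \<Longrightarrow> q < n \<Longrightarrow> p \<noteq> q \<Longrightarrow> (d\<^sup>T * (b1\<^sup>T * S * b1) * d) $$ (p, q) \<noteq> 0 \<Longrightarrow>
       \<exists>a. (d\<^sup>T * (b1\<^sup>T * S * b1) * d) $$ (p, q) = tmono im a"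
    using normalise_monomial[OF qc im0 mT congruence_symmetric[OF b1c S(1,2)]] by blast
  define b where "b = b1 * d"
  define w where "w = b\<^sup>T * S * b"
  have b: "b \<in> GL_Iwahori n" unfolding b_def by (rule GL_Iwahori_mult[OF b1 d])
  have bc: "b \<in> carrier_mat n n" by (rule GL_IwahoriD(1)[OF b])
  have "d\<^sup>T * (b1\<^sup>T * S * b1) * d = w"
    unfolding w_def b_def by (rule congruence_congruence[OF b1c GL_IwahoriD(1)[OF d] S(1)])
  note w = w0[unfolded this]
  have wc: "w \<in> carrier_mat n n" and ws: "w\<^sup>T = w"
    using congruence_symmetric[OF bc S(1,2)] bc S(1) by (auto simp: w_def)
  have shape: "apm_shape im n w"
  proof (cases "\<exists>p<n. w $$ (p, p) \<noteq> 0")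
    case True
    then show ?thesis unfolding apm_shape_def using w ws by (simp only: if_True) blast
  next
    case False
    have "if p = 0 \<or> q = 0 then \<exists>a. w $$ (p, q) = tmono im a \<or> w $$ (p, q) = tmono (- im) a
              else \<exists>a. w $$ (p, q) = tmono im a" if pq: "p < n" "q < n" "w $$ (p, q) \<noteq> 0" for p q
    proof -
      have "p \<noteq> q" using False pq by blast
      then show ?thesis using w(3)[OF pq(1,2)] pq(3) by auto
    qed
    with False w(1) ws show ?thesis unfolding apm_shape_def by (simp only: if_False) blast
  qed
  have "fls_nth (det b) 0 \<noteq> 0"
    unfolding GL_Iwahori_det(2)[OF b] using GL_IwahoriD(4)[OF b] by simp
  with GL_Iwahori_det(1)[OF b] have db: "det b \<noteq> 0" "fls_subdegree (det b) = 0"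
    by (auto simp: frac_ideal_def intro: antisym fls_subdegree_leI)
  have dw: "det w = det b ^ 2" unfolding w_def det_congruence[OF bc S(1)] S(3) by simp
  then have "fls_subdegree (det w) = 0" using db by (simp add: power2_eq_square)
  from det_symmetric_monomial[OF w(1) ws this] have ev: "even (\<Sum>j<n. expo n w j)" by simp
  \<comment> \<open>The determinant of \<open>w\<close> is a unit and the square of a power of \<open>t\<close>, hence equal to \<open>1\<close>.\<close>
  obtain N where N: "det (gmat im s n w) = tmono 1 N" using gmat_gram(3)[OF two im s shape ev] by blast
  note G = gmat_gram(1,2)[OF two im s shape ev]
  have "det w = det (gmat im s n w) * det (gmat im s n w)"
    using det_mult[of "(gmat im s n w)\<^sup>T" n "gmat im s n w"] det_transpose[OF G(1)] G by simp
  then have dN: "det w = tmono 1 (N + N)" by (simp only: N tmono_mult mult_1)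
  then have "N + N = 0"
    using \<open>fls_subdegree (det w) = 0\<close> tmono_subdegree[of "1::'k" "N + N"] by simp
  then have dw1: "det w = 1" using dN by (simp add: tmono_def)
  then have "det b ^ 2 = 1" using dw by simp
  then consider "det b = 1" | "det b = - 1" by (auto simp: power2_eq_1_iff)
  then show ?thesis
  proof cases
    case 1
    then have "b \<in> Iwahori n" using b bc by (simp add: Iwahori_eq SL_def)
    moreover have "w \<in> iSymAPM im n" using shape wc dw1 by (simp add: iSymAPM_iff SL_def)
    ultimately show ?thesis using that unfolding w_def by blast
  next
    case 2
    \<comment> \<open>Negating one basis vector corrects the determinant. A vector with \<open>w\<^sub>p\<^sub>p \<noteq> 0\<close> is taken if there is
      one, and then \<open>w\<close> does not change; otherwise the first vector is taken, and only the sign in the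
      first row and column changes.\<close>
    define p0 where "p0 = (if \<exists>p<n. w $$ (p, p) \<noteq> 0 then SOME p. p < n \<and> w $$ (p, p) \<noteq> 0 else 0)"
    have p0: "p0 < n" "(\<exists>p<n. w $$ (p, p) \<noteq> 0) \<Longrightarrow> w $$ (p0, p0) \<noteq> 0"
      "\<not> (\<exists>p<n. w $$ (p, p) \<noteq> 0) \<Longrightarrow> p0 = 0"
      using someI_ex[of "\<lambda>p. p < n \<and> w $$ (p, p) \<noteq> 0"] n by (auto simp: p0_def)
    define D where "D = mat_diag n (\<lambda>i. if i = p0 then - 1 else (1 :: 'k fls))"
    define w' where "w' = D\<^sup>T * w * D"
    have D: "D \<in> GL_Iwahori n" unfolding D_def by (rule mat_diag_in_GL_Iwahori) auto
    note Dc = GL_IwahoriD(1)[OF D]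
    have "det D = (\<Prod>i<n. if i = p0 then - 1 else 1)"
      using det_upper_triangular[of D n] Dc
      by (auto simp: D_def mat_diag_def diag_mat_def prod.list_conv_set_nth atLeast0LessThan upper_triangular_def)
    also have "\<dots> = - 1" using p0(1) by simp
    finally have detD: "det D = - 1" .
    have w': "w' $$ (p, q) = (if (p = p0) = (q = p0) then w $$ (p, q) else - w $$ (p, q))"
      if "p < n" "q < n" for p q
      unfolding w'_def D_def mat_diag_congruence_nth[OF wc that] by simp
    have wc': "w' \<in> carrier_mat n n" and ws': "w'\<^sup>T = w'"
      using congruence_symmetric[OF Dc wc ws] Dc wc by (auto simp: w'_def)
    have mw': "monomial_mat n w'" by (rule monomial_mat_cong[OF w(1) wc']) (auto simp: w')
    have det': "det w' = 1"
      unfolding w'_def det_congruence[OF Dc wc] detD dw1 by simp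
    have "apm_shape im n w'"
    proof (cases "\<exists>p<n. w $$ (p, p) \<noteq> 0")
      case True
      have "w $$ (p, q) = 0" if "p < n" "q < n" "(p = p0) \<noteq> (q = p0)" for p q
        using w(1) p0 True that unfolding monomial_mat_def by metis
      then have "w' = w" using wc wc' by (intro eq_matI) (auto simp: w')
      then show ?thesis using shape by simp
    next
      case False
      note p00 = p0(3)[OF False]
      have no: "\<not> (\<exists>p<n. w' $$ (p, p) \<noteq> 0)" using False by (auto simp: w')
      have "if p = 0 \<or> q = 0 then \<exists>a. w' $$ (p, q) = tmono im a \<or> w' $$ (p, q) = tmono (- im) a
              else \<exists>a. w' $$ (p, q) = tmono im a" if pq: "p < n" "q < n" "w' $$ (p, q) \<noteq> 0" for p q
      proof -
        have "w $$ (p, q) \<noteq> 0" "p \<noteq> q" using pq w'[OF pq(1,2)] no by (auto split: if_splits)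
        then obtain a where a: "w $$ (p, q) = tmono im a" using w(3)[OF pq(1,2)] by blast
        then show ?thesis using w'[OF pq(1,2)] p00 \<open>p \<noteq> q\<close> by (auto simp: tmono_uminus)
      qed
      with no mw' ws' show ?thesis unfolding apm_shape_def by (simp only: if_False) blast
    qed
    then have "w' \<in> iSymAPM im n" using wc' det' by (simp add: iSymAPM_iff SL_def)
    moreover have "w' = (b * D)\<^sup>T * S * (b * D)"
      unfolding w'_def w_def by (rule congruence_congruence[OF bc Dc S(1)])
    moreover have "b * D \<in> Iwahori n"
      using GL_Iwahori_mult[OF b D] bc Dc det_mult[OF bc Dc] 2 detD
      by (simp add: Iwahori_eq SL_def)
    ultimately show ?thesis using that by metis
  qed
qed

section \<open>Double cosets and congruence classes\<close>

lemma congruence_one: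
  fixes h :: "'a::comm_ring_1 mat"
  shows "h \<in> carrier_mat n n \<Longrightarrow> h\<^sup>T * 1\<^sub>m n * h = h\<^sup>T * h"
  by simp

lemma SL_inverse:
  fixes g :: "'a::comm_ring_1 mat"
  assumes "g \<in> SL n"
  obtains h where "h \<in> SL n" "h * g = 1\<^sub>m n" "g * h = 1\<^sub>m n"
proof -
  have g: "g \<in> carrier_mat n n" "det g = 1" using assms by (auto simp: SL_def)
  note a = adj_mat[OF g(1)]
  have one: "1 \<cdot>\<^sub>m 1\<^sub>m n = (1\<^sub>m n :: 'a mat)" by (rule eq_matI) auto
  have hg: "adj_mat g * g = 1\<^sub>m n" using a(3) g(2) one by simp
  have "det (adj_mat g) = 1" using det_mult[OF a(1) g(1)] hg g(2) by simp
  then show ?thesis using that[of "adj_mat g"] a g hg one by (simp add: SL_def)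
qed

lemma one_in_SO: "1\<^sub>m n \<in> SO n"
  by (simp add: SO_def SL_def)

lemma SO_mult:
  fixes k l :: "'a::comm_ring_1 mat"
  assumes "k \<in> SO n" "l \<in> SO n"
  shows "k * l \<in> SO n"
proof -
  have k: "k \<in> carrier_mat n n" "det k = 1" "k\<^sup>T * k = 1\<^sub>m n"
    and l: "l \<in> carrier_mat n n" "det l = 1" "l\<^sup>T * l = 1\<^sub>m n"
    using assms by (auto simp: SO_def SL_def)
  have "(k * l)\<^sup>T * 1\<^sub>m n * (k * l) = l\<^sup>T * (k\<^sup>T * 1\<^sub>m n * k) * l"
    by (rule congruence_congruence[symmetric, OF k(1) l(1)]) simp
  also have "\<dots> = 1\<^sub>m n" using k l by simp
  finally show ?thesis using k l det_mult[OF k(1) l(1)] by (simp add: SO_def SL_def)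
qed

lemma SO_inverse:
  fixes k :: "'a::field mat"
  assumes "k \<in> SO n"
  shows "k\<^sup>T \<in> SO n" "k\<^sup>T * k = 1\<^sub>m n"
proof -
  have k: "k \<in> carrier_mat n n" "det k = 1" and kk: "k\<^sup>T * k = 1\<^sub>m n"
    using assms by (auto simp: SO_def SL_def)
  then have "k * k\<^sup>T = 1\<^sub>m n" using mat_mult_left_right_inverse[of "k\<^sup>T" n k] by simp
  then show "k\<^sup>T \<in> SO n" using k det_transpose[OF k(1)] by (simp add: SO_def SL_def)
  show "k\<^sup>T * k = 1\<^sub>m n" by (rule kk)
qed

lemma double_coset_subset:
  assumes "g \<in> carrier_mat n n" "k \<in> SO n" "b \<in> Iwahori n"
  shows "double_coset (SO n) (k * g * b) (Iwahori n) \<subseteq> double_coset (SO n) g (Iwahori n)"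
proof
  fix x assume "x \<in> double_coset (SO n) (k * g * b) (Iwahori n)"
  then obtain k' b' where kb: "k' \<in> SO n" "b' \<in> Iwahori n" and x: "x = k' * (k * g * b) * b'"
    by (auto simp: double_coset_def)
  have c: "k \<in> carrier_mat n n" "k' \<in> carrier_mat n n" "b \<in> carrier_mat n n" "b' \<in> carrier_mat n n"
    using assms kb by (auto simp: SO_def SL_def Iwahori_eq)
  have "k' * (k * g * b) = k' * k * (g * b)"
    using c assms(1) by (simp add: assoc_mult_mat[of _ n n _ n _ n])
  then have "x = (k' * k) * g * (b * b')"
    unfolding x using c assms(1) by (simp add: assoc_mult_mat[of _ n n _ n _ n])
  then show "x \<in> double_coset (SO n) g (Iwahori n)"
    using SO_mult[OF kb(1) assms(2)] Iwahori_mult[OF assms(3) kb(2)] by (auto simp: double_coset_def)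
qed

lemma double_coset_eq:
  fixes g :: "'k::field fls mat"
  assumes g: "g \<in> carrier_mat n n" and k: "k \<in> SO n" and b: "b \<in> Iwahori n"
  shows "double_coset (SO n) (k * g * b) (Iwahori n) = double_coset (SO n) g (Iwahori n)"
proof
  show "double_coset (SO n) (k * g * b) (Iwahori n) \<subseteq> double_coset (SO n) g (Iwahori n)"
    by (rule double_coset_subset[OF assms])
  obtain c where c: "c \<in> Iwahori n" "b * c = 1\<^sub>m n" by (rule Iwahori_inverse[OF b])
  have cc: "k \<in> carrier_mat n n" "b \<in> carrier_mat n n" "c \<in> carrier_mat n n"
    using assms c by (auto simp: SO_def SL_def Iwahori_eq)
  have "k\<^sup>T * (k * g * b) * c = (k\<^sup>T * k) * g * (b * c)"
    using cc g by (simp add: assoc_mult_mat[of _ n n _ n _ n])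
  then have "k\<^sup>T * (k * g * b) * c = g" using SO_inverse(2)[OF k] c g by simp
  then show "double_coset (SO n) g (Iwahori n) \<subseteq> double_coset (SO n) (k * g * b) (Iwahori n)"
    using double_coset_subset[of "k * g * b" n "k\<^sup>T" c] SO_inverse(1)[OF k] c(1) cc g by simp
qed

lemma double_coset_self:
  assumes "g \<in> carrier_mat n n"
  shows "g \<in> double_coset (SO n) g (Iwahori n)"
proof -
  have "g = 1\<^sub>m n * g * 1\<^sub>m n" using assms by simp
  then show ?thesis using one_in_SO one_in_Iwahori unfolding double_coset_def by blast
qed

text \<open>Two elements with the same Gram matrix differ by an orthogonal matrix on the left. Hence double
  cosets correspond to Iwahori congruence classes of Gram matrices.\<close>

lemma congruent_gram_same_double_coset:
  fixes g h :: "'k::field fls mat"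
  assumes g: "g \<in> SL n" and h: "h \<in> SL n" and b: "b \<in> Iwahori n"
    and eq: "h\<^sup>T * h = b\<^sup>T * (g\<^sup>T * g) * b"
  shows "double_coset (SO n) h (Iwahori n) = double_coset (SO n) g (Iwahori n)"
proof -
  have gc: "g \<in> carrier_mat n n" "det g = 1" and hc: "h \<in> carrier_mat n n" "det h = 1"
    and bc: "b \<in> carrier_mat n n" "det b = 1"
    using assms by (auto simp: SL_def Iwahori_eq)
  have gb: "g * b \<in> SL n" using gc bc det_mult[of g n b] by (simp add: SL_def)
  obtain c where c: "c \<in> SL n" "c * (g * b) = 1\<^sub>m n" "g * b * c = 1\<^sub>m n" by (rule SL_inverse[OF gb])
  have cc: "c \<in> carrier_mat n n" "det c = 1" using c by (auto simp: SL_def)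
  define k where "k = h * c"
  have "k\<^sup>T * k = c\<^sup>T * (h\<^sup>T * h) * c"
    using congruence_congruence[OF hc(1) cc(1), of "1\<^sub>m n"] hc cc by (simp add: k_def)
  also have "h\<^sup>T * h = (g * b)\<^sup>T * 1\<^sub>m n * (g * b)"
    using congruence_congruence[OF gc(1) bc(1), of "1\<^sub>m n"] gc by (simp add: eq)
  also have "c\<^sup>T * \<dots> * c = (g * b * c)\<^sup>T * 1\<^sub>m n * (g * b * c)"
    using congruence_congruence[of "g * b" n c "1\<^sub>m n"] gc bc cc by simp
  also have "\<dots> = 1\<^sub>m n" unfolding c(3) by simp
  finally have k: "k \<in> SO n"
    using hc cc det_mult[OF hc(1) cc(1)] by (simp add: SO_def SL_def k_def)
  have "k * g * b = h * (c * (g * b))"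
    unfolding k_def using hc cc gc bc by (simp add: assoc_mult_mat[of _ n n _ n _ n])
  then have "k * g * b = h" using c(2) hc by simp
  then show ?thesis using double_coset_eq[OF gc(1) k b] by simp
qed

lemma same_double_coset_congruent_gram:
  fixes g h :: "'k::field fls mat"
  assumes g: "g \<in> carrier_mat n n" and h: "h \<in> carrier_mat n n"
    and eq: "double_coset (SO n) g (Iwahori n) = double_coset (SO n) h (Iwahori n)"
  obtains b where "b \<in> Iwahori n" "h\<^sup>T * h = b\<^sup>T * (g\<^sup>T * g) * b"
proof -
  have "h \<in> double_coset (SO n) g (Iwahori n)" unfolding eq by (rule double_coset_self[OF h])
  then obtain k b where k: "k \<in> SO n" and b: "b \<in> Iwahori n" and hk: "h = k * g * b"
    by (auto simp: double_coset_def)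
  have kc: "k \<in> carrier_mat n n" "k\<^sup>T * k = 1\<^sub>m n" and bc: "b \<in> carrier_mat n n"
    using k b by (auto simp: SO_def SL_def Iwahori_eq)
  have kg: "k * g \<in> carrier_mat n n" and kgb: "k * g * b \<in> carrier_mat n n" using kc g bc by auto
  have "h\<^sup>T * h = b\<^sup>T * ((k * g)\<^sup>T * (k * g)) * b"
    using congruence_congruence[OF kg bc, of "1\<^sub>m n"]
    unfolding congruence_one[OF kg] congruence_one[OF kgb] hk by simp
  also have "(k * g)\<^sup>T * (k * g) = g\<^sup>T * g"
    using congruence_congruence[OF kc(1) g, of "1\<^sub>m n"] kc g by simp
  finally show ?thesis using that b by blast
qed

theorem corollary1p7:
  fixes im :: "'k::field" and s :: "'k fps" and n :: nat
  assumes "n > 0"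
    and "quadratically_closed TYPE('k)"
    and "im ^ 2 = -1"
    and "s ^ 2 = fps_X - 1"
  shows "bij_betw (\<lambda>w. double_coset (SO n) (gmat im s n w) (Iwahori n))
           (iSymAPM im n) (double_cosets (SO n) (SL n) (Iwahori n))"
proof -
  let ?g = "gmat im s n"
  have two: "(2::'k) \<noteq> 0" by (rule two_nonzero_of_quadratically_closed[OF assms(2)])
  have im0: "im \<noteq> 0" using assms(3) by auto
  note G = gmat_iSymAPM[OF two assms(3,4)]
  have carr: "?g w \<in> carrier_mat n n" if "w \<in> iSymAPM im n" for w
    using G(1)[OF that] by (simp add: SL_def)
  show ?thesis
    unfolding bij_betw_def
  proof
    show "inj_on (\<lambda>w. double_coset (SO n) (?g w) (Iwahori n)) (iSymAPM im n)"
    proof (rule inj_onI)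
      fix w w' assume w: "w \<in> iSymAPM im n" and w': "w' \<in> iSymAPM im n"
        and eq: "double_coset (SO n) (?g w) (Iwahori n) = double_coset (SO n) (?g w') (Iwahori n)"
      from same_double_coset_congruent_gram[OF carr[OF w] carr[OF w'] eq]
      obtain b where b: "b \<in> Iwahori n" "w' = b\<^sup>T * w * b"
        unfolding G(2)[OF w] G(2)[OF w'] by blast
      show "w = w'" by (rule congruent_iSymAPM_eq[OF assms(1) two im0 w w' b, symmetric])
    qed
    show "(\<lambda>w. double_coset (SO n) (?g w) (Iwahori n)) ` iSymAPM im n =
        double_cosets (SO n) (SL n) (Iwahori n)"
    proof (intro equalityI subsetI)
      fix X :: "'k fls mat set" assume "X \<in> double_cosets (SO n) (SL n) (Iwahori n)"
      then obtain g :: "'k fls mat" where g: "g \<in> SL n" and X: "X = double_coset (SO n) g (Iwahori n)"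
        by (auto simp: double_cosets_def)
      then have gc: "g \<in> carrier_mat n n" "det g = 1" by (auto simp: SL_def)
      have "(g\<^sup>T * g)\<^sup>T = g\<^sup>T * g" using congruence_symmetric[OF gc(1), of "1\<^sub>m n"] gc by simp
      moreover have "det (g\<^sup>T * g) = 1"
        using det_mult[of "g\<^sup>T" n g] det_transpose[OF gc(1)] gc by simp
      ultimately obtain b where b: "b \<in> Iwahori n" and w: "b\<^sup>T * (g\<^sup>T * g) * b \<in> iSymAPM im n"
        using congruent_to_iSymAPM[OF assms, of "g\<^sup>T * g"] gc by auto
      from congruent_gram_same_double_coset[OF g G(1)[OF w] b G(2)[OF w]] w X
      show "X \<in> (\<lambda>w. double_coset (SO n) (?g w) (Iwahori n)) ` iSymAPM im n" by blast
    qed (use G(1) in \<open>auto simp: double_cosets_def\<close>)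
  qed
qed

end
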